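(* Let $G_1$ and $G_2$ be totally disconnected compact groups and, for $i\in\{1,2\}$, let $\varphi_i:G_i\to H_i$ be an isomorphism (of topological groups) of $G_i$ onto a compact open subgroup $H_i\le G_i$. Let $$G:=\langle G_1\times G_2,\ t\mid t^{-1}(h_1,g_2)t=(\varphi_1^{-1}(h_1),\varphi_2(g_2))\ \text{ for all }(h_1,g_2)\in H_1\times G_2\rangle$$ be the HNN-extension of $G_1\times G_2$ with stable letter $t$, equipped with the unique group topology making the inclusion of $U:=G_1\times G_2$ into $G$ continuous and open, so that $G$ is a totally disconnected locally compact group with compact open subgroup $U$. Let $\beta\in\mathrm{End}(G)$ be the continuous endomorphism determined by $\beta(t)=t$ and $\beta(g_1,g_2)=(\varphi_1(g_1),g_2)$ for all $(g_1,g_2)\in G_1\times G_2$, and let $\alpha:=c_t\circ\beta\in\mathrm{End}(G)$, where $c_t:G\to G$, $g\mapsto tgt^{-1}$. Then $U$ is tidy for $\alpha$ and $s(\alpha)=[G_2:H_2]$.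
   Context: $\mathrm{End}(G)$ is the semigroup of continuous homomorphisms $G\to G$; $\alpha^{-k}$ denotes preimage under $\alpha^k$. Set $U_0:=U$, $U_{n+1}:=U\cap\alpha(U_n)$ and $U_{-n}:=\bigcap_{k=0}^n\alpha^{-k}(U)$ for $n\in\mathbb{N}_0$; $U_+:=\bigcap_{n\in\mathbb{N}_0}U_n$, $U_-:=\bigcap_{n\in\mathbb{N}_0}U_{-n}$, $U_{--}:=\bigcup_{n\in\mathbb{N}_0}\alpha^{-n}(U_-)$. $U$ is tidy for $\alpha$ if $U=U_+U_-$ (tidy above) and $U_{--}$ is closed in $G$ (tidy below). The scale is $s(\alpha)=\min\{[\alpha(W):W\cap\alpha(W)]\mid W\le G\text{ compact open}\}$. *)

theory Defs
  imports "HOL-Analysis.Analysis" "HOL-Algebra.Coset"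
begin

section \<open>Topological groups\<close>

definition topological_group :: "('a, 'm) monoid_scheme \<Rightarrow> 'a topology \<Rightarrow> bool" where
  "topological_group G T \<longleftrightarrow>
     group G \<and> topspace T = carrier G \<and>
     continuous_map (prod_topology T T) T (\<lambda>(x, y). x \<otimes>\<^bsub>G\<^esub> y) \<and>
     continuous_map T T (\<lambda>x. inv\<^bsub>G\<^esub> x)"

definition totally_disconnected_space :: "'a topology \<Rightarrow> bool" where
  "totally_disconnected_space T \<longleftrightarrow> (\<forall>S. connectedin T S \<longrightarrow> (\<exists>a. S \<subseteq> {a}))"

text \<open>No separation axiom is required: in a totally disconnected space the points are closed,
  and a topological group whose points are closed is Hausdorff.\<close>

definition totally_disconnected_compact_group ::
    "('a, 'm) monoid_scheme \<Rightarrow> 'a topology \<Rightarrow> bool" where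
  "totally_disconnected_compact_group G T \<longleftrightarrow>
     topological_group G T \<and> totally_disconnected_space T \<and> compact_space T"

definition compact_open_subgroup ::
    "('a, 'm) monoid_scheme \<Rightarrow> 'a topology \<Rightarrow> 'a set \<Rightarrow> bool" where
  "compact_open_subgroup G T W \<longleftrightarrow> subgroup W G \<and> compactin T W \<and> openin T W"

definition topological_iso_onto ::
    "('a, 'm) monoid_scheme \<Rightarrow> 'a topology \<Rightarrow> ('b, 'n) monoid_scheme \<Rightarrow> 'b topology
      \<Rightarrow> 'b set \<Rightarrow> ('a \<Rightarrow> 'b) \<Rightarrow> bool" where
  "topological_iso_onto G T G' T' H \<phi> \<longleftrightarrow>
     \<phi> \<in> iso G (G'\<lparr>carrier := H\<rparr>) \<and> homeomorphic_map T (subtopology T' H) \<phi>"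

definition top_End :: "('a, 'm) monoid_scheme \<Rightarrow> 'a topology \<Rightarrow> ('a \<Rightarrow> 'a) set" where
  "top_End G T = {\<alpha> \<in> hom G G. continuous_map T T \<alpha>}"

text \<open>An infinite index is sent to \<open>0\<close>. This does not occur below: an open subgroup of a compact
  group has finite index, and \<open>W \<inter> \<alpha>(W)\<close> is open in the compact group \<open>\<alpha>(W)\<close>
  if \<open>W\<close> is a compact open subgroup and \<open>\<alpha>\<close> a continuous endomorphism.\<close>

definition subgroup_index :: "('a, 'm) monoid_scheme \<Rightarrow> 'a set \<Rightarrow> nat" where
  "subgroup_index G H = card (rcosets\<^bsub>G\<^esub> H)"


section \<open>Tidy subgroups and the scale\<close>

definition pow_vimage :: "('a, 'm) monoid_scheme \<Rightarrow> ('a \<Rightarrow> 'a) \<Rightarrow> nat \<Rightarrow> 'a set \<Rightarrow> 'a set" where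
  "pow_vimage G \<alpha> k V = {g \<in> carrier G. (\<alpha> ^^ k) g \<in> V}"

primrec U_pos :: "('a \<Rightarrow> 'a) \<Rightarrow> 'a set \<Rightarrow> nat \<Rightarrow> 'a set" where
  "U_pos \<alpha> U 0 = U"
| "U_pos \<alpha> U (Suc n) = U \<inter> \<alpha> ` U_pos \<alpha> U n"

definition U_neg :: "('a, 'm) monoid_scheme \<Rightarrow> ('a \<Rightarrow> 'a) \<Rightarrow> 'a set \<Rightarrow> nat \<Rightarrow> 'a set" where
  "U_neg G \<alpha> U n = (\<Inter>k\<in>{0..n}. pow_vimage G \<alpha> k U)"

definition U_plus :: "('a \<Rightarrow> 'a) \<Rightarrow> 'a set \<Rightarrow> 'a set" where
  "U_plus \<alpha> U = (\<Inter>n. U_pos \<alpha> U n)"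

definition U_minus :: "('a, 'm) monoid_scheme \<Rightarrow> ('a \<Rightarrow> 'a) \<Rightarrow> 'a set \<Rightarrow> 'a set" where
  "U_minus G \<alpha> U = (\<Inter>n. U_neg G \<alpha> U n)"

definition U_minus_minus :: "('a, 'm) monoid_scheme \<Rightarrow> ('a \<Rightarrow> 'a) \<Rightarrow> 'a set \<Rightarrow> 'a set" where
  "U_minus_minus G \<alpha> U = (\<Union>n. pow_vimage G \<alpha> n (U_minus G \<alpha> U))"

definition tidy_above :: "('a, 'm) monoid_scheme \<Rightarrow> ('a \<Rightarrow> 'a) \<Rightarrow> 'a set \<Rightarrow> bool" where
  "tidy_above G \<alpha> U \<longleftrightarrow> U = U_plus \<alpha> U <#>\<^bsub>G\<^esub> U_minus G \<alpha> U"

definition tidy_below ::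
    "('a, 'm) monoid_scheme \<Rightarrow> 'a topology \<Rightarrow> ('a \<Rightarrow> 'a) \<Rightarrow> 'a set \<Rightarrow> bool" where
  "tidy_below G T \<alpha> U \<longleftrightarrow> closedin T (U_minus_minus G \<alpha> U)"

definition tidy ::
    "('a, 'm) monoid_scheme \<Rightarrow> 'a topology \<Rightarrow> ('a \<Rightarrow> 'a) \<Rightarrow> 'a set \<Rightarrow> bool" where
  "tidy G T \<alpha> U \<longleftrightarrow> tidy_above G \<alpha> U \<and> tidy_below G T \<alpha> U"

definition endo_scale :: "('a, 'm) monoid_scheme \<Rightarrow> 'a topology \<Rightarrow> ('a \<Rightarrow> 'a) \<Rightarrow> nat" where
  "endo_scale G T \<alpha> =
     (LEAST n. \<exists>W. compact_open_subgroup G T W \<and>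
        n = subgroup_index (G\<lparr>carrier := \<alpha> ` W\<rparr>) (W \<inter> \<alpha> ` W))"


section \<open>HNN-extensions\<close>

text \<open>The group \<open>\<langle>B, t | t\<inverse> a t = \<theta> a for all a \<in> A\<rangle>\<close>, as the set of words in the elements of
  \<open>B\<close> and the letters \<open>t\<close>, \<open>t\<inverse>\<close> modulo the least congruence that contains the
  multiplication table of \<open>B\<close>, the cancellation of \<open>t\<close> against \<open>t\<inverse>\<close> and the
  defining relations.\<close>

datatype 'b hnn_letter = Base 'b | Stable | Stable_Inv

definition hnn_words :: "('b, 'm) monoid_scheme \<Rightarrow> 'b hnn_letter list set" where
  "hnn_words B = lists (Base ` carrier B \<union> {Stable, Stable_Inv})"

inductive hnn_cong ::
    "('b, 'm) monoid_scheme \<Rightarrow> 'b set \<Rightarrow> ('b \<Rightarrow> 'b)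
      \<Rightarrow> 'b hnn_letter list \<Rightarrow> 'b hnn_letter list \<Rightarrow> bool"
  for B A \<theta> where
  refl: "w \<in> hnn_words B \<Longrightarrow> hnn_cong B A \<theta> w w"
| sym: "hnn_cong B A \<theta> v w \<Longrightarrow> hnn_cong B A \<theta> w v"
| trans: "hnn_cong B A \<theta> u v \<Longrightarrow> hnn_cong B A \<theta> v w \<Longrightarrow> hnn_cong B A \<theta> u w"
| append: "hnn_cong B A \<theta> v v' \<Longrightarrow> hnn_cong B A \<theta> w w' \<Longrightarrow> hnn_cong B A \<theta> (v @ w) (v' @ w')"
| base_one: "hnn_cong B A \<theta> [Base \<one>\<^bsub>B\<^esub>] []"
| base_mult: "a \<in> carrier B \<Longrightarrow> b \<in> carrier B \<Longrightarrow>
    hnn_cong B A \<theta> [Base a, Base b] [Base (a \<otimes>\<^bsub>B\<^esub> b)]"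
| cancel_right: "hnn_cong B A \<theta> [Stable, Stable_Inv] []"
| cancel_left: "hnn_cong B A \<theta> [Stable_Inv, Stable] []"
| stable: "a \<in> A \<Longrightarrow> hnn_cong B A \<theta> [Stable_Inv, Base a, Stable] [Base (\<theta> a)]"

definition hnn_class ::
    "('b, 'm) monoid_scheme \<Rightarrow> 'b set \<Rightarrow> ('b \<Rightarrow> 'b) \<Rightarrow> 'b hnn_letter list
      \<Rightarrow> 'b hnn_letter list set" where
  "hnn_class B A \<theta> w = {v. hnn_cong B A \<theta> w v}"

definition hnn_extension ::
    "('b, 'm) monoid_scheme \<Rightarrow> 'b set \<Rightarrow> ('b \<Rightarrow> 'b) \<Rightarrow> 'b hnn_letter list set monoid" where
  "hnn_extension B A \<theta> =
     \<lparr>carrier = hnn_class B A \<theta> ` hnn_words B,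
      monoid.mult = (\<lambda>X Y. \<Union>v\<in>X. \<Union>w\<in>Y. hnn_class B A \<theta> (v @ w)),
      one = hnn_class B A \<theta> []\<rparr>"

definition hnn_incl ::
    "('b, 'm) monoid_scheme \<Rightarrow> 'b set \<Rightarrow> ('b \<Rightarrow> 'b) \<Rightarrow> 'b \<Rightarrow> 'b hnn_letter list set" where
  "hnn_incl B A \<theta> b = hnn_class B A \<theta> [Base b]"

definition hnn_stable ::
    "('b, 'm) monoid_scheme \<Rightarrow> 'b set \<Rightarrow> ('b \<Rightarrow> 'b) \<Rightarrow> 'b hnn_letter list set" where
  "hnn_stable B A \<theta> = hnn_class B A \<theta> [Stable]"

definition hnn_topology ::
    "('b, 'm) monoid_scheme \<Rightarrow> 'b topology \<Rightarrow> 'b set \<Rightarrow> ('b \<Rightarrow> 'b)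
      \<Rightarrow> 'b hnn_letter list set topology" where
  "hnn_topology B S A \<theta> =
     (THE T. topological_group (hnn_extension B A \<theta>) T \<and>
        continuous_map S T (hnn_incl B A \<theta>) \<and> open_map S T (hnn_incl B A \<theta>))"


text \<open>The extensionality clause only fixes the values outside the carrier.\<close>

definition hnn_endo ::
    "('b, 'm) monoid_scheme \<Rightarrow> 'b topology \<Rightarrow> 'b set \<Rightarrow> ('b \<Rightarrow> 'b) \<Rightarrow> ('b \<Rightarrow> 'b)
      \<Rightarrow> 'b hnn_letter list set \<Rightarrow> 'b hnn_letter list set" where
  "hnn_endo B S A \<theta> \<psi> =
     (THE \<beta>. \<beta> \<in> top_End (hnn_extension B A \<theta>) (hnn_topology B S A \<theta>) \<and>
        \<beta> \<in> extensional (carrier (hnn_extension B A \<theta>)) \<and>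
        \<beta> (hnn_stable B A \<theta>) = hnn_stable B A \<theta> \<and>
        (\<forall>b\<in>carrier B. \<beta> (hnn_incl B A \<theta> b) = hnn_incl B A \<theta> (\<psi> b)))"

definition conj_by :: "('a, 'm) monoid_scheme \<Rightarrow> 'a \<Rightarrow> 'a \<Rightarrow> 'a" where
  "conj_by G t g = t \<otimes>\<^bsub>G\<^esub> g \<otimes>\<^bsub>G\<^esub> inv\<^bsub>G\<^esub> t"

end

theory Submission
  imports Defs "HOL-Algebra.Bij"
begin

text \<open>
  Write \<open>(g\<^sub>1, g\<^sub>2)\<close> for an element of \<open>U\<close>. Since \<open>t \<theta>(a) t\<inverse> = a\<close> for \<open>a\<close> in \<open>A\<close>, conjugation by
  \<open>t\<close> applies \<open>\<phi>\<^sub>1\<close> to the first coordinate and undoes \<open>\<phi>\<^sub>2\<close> in the second one, so that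
  \<open>\<alpha>(g\<^sub>1, \<phi>\<^sub>2(c)) = (\<phi>\<^sub>1(\<phi>\<^sub>1(g\<^sub>1)), c)\<close>; iterated, this is \<open>alpha_pow_incl\<close>. Everything rests on the
  converse: \<open>\<alpha>\<^sup>n(g\<^sub>1, g\<^sub>2)\<close> lies in \<open>U\<close> only if \<open>g\<^sub>2\<close> lies in \<open>\<phi>\<^sub>2\<^sup>n(G\<^sub>2)\<close> (\<open>alpha_pow_incl_in_U_iff\<close>).
  This is a case of Britton's lemma, but it follows without normal forms. Forgetting \<open>G\<^sub>1\<close> maps
  the extension onto the ascending HNN-extension in which conjugation by \<open>t\<inverse>\<close> induces \<open>\<phi>\<^sub>2\<close> on
  \<open>G\<^sub>2\<close>, and \<open>G\<^sub>2\<close> embeds in a permutation group with that property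
  (\<open>endomorphism_as_conjugation\<close>). There, \<open>\<alpha>\<^sup>n(g\<^sub>1, g\<^sub>2) = (b, c)\<close> becomes
  \<open>g\<^sub>2 = \<phi>\<^sub>2\<^sup>n(c)\<close>.

  Tidiness follows at once. The elements \<open>(1, c)\<close> lie in \<open>U\<^sub>+\<close>, because \<open>(1, c) = \<alpha>(1, \<phi>\<^sub>2(c))\<close>, and the
  elements \<open>(g, 1)\<close> lie in \<open>U\<^sub>-\<close>; hence \<open>U = U\<^sub>+U\<^sub>-\<close>. As the subgroups \<open>\<phi>\<^sub>2\<^sup>n(G\<^sub>2)\<close> decrease, an
  orbit that starts in \<open>U\<close> and ends up in \<open>U\<close> never leaves it, so \<open>U\<^sub>-\<^sub>- \<inter> U = U\<^sub>-\<close>. This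
  intersection is closed, and a subgroup that is closed near the identity is closed.

  For \<open>n = 1\<close> the criterion identifies the cosets of \<open>U \<inter> \<alpha>(U)\<close> in \<open>\<alpha>(U)\<close> with those of \<open>H\<^sub>2\<close>
  in \<open>G\<^sub>2\<close>, so \<open>U\<close> has displacement index \<open>s = [G\<^sub>2 : H\<^sub>2]\<close>. No compact open subgroup does better
  because \<open>s\<close> is a rate of growth: \<open>\<alpha>\<^sup>n(U)\<close> meets at least \<open>s\<^sup>n\<close> cosets of \<open>U\<close>
  (\<open>powers_of_index\<close>), whereas a subgroup \<open>W\<close> with displacement index \<open>m\<close> has \<open>\<alpha>\<^sup>n(W)\<close> covered
  by \<open>m\<^sup>n\<close> of its cosets; passing between \<open>U\<close> and \<open>W\<close> costs a factor that does not depend on \<open>n\<close>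
  (\<open>index_ge_if_growth\<close>).

  The topology of the extension and \<open>\<beta>\<close> are given by definite descriptions, which have to be shown to
  denote. A group topology is determined by the neighbourhoods of the identity, here those of
  \<open>U\<close>; they define one because conjugation by \<open>t\<close> and by \<open>t\<inverse>\<close> is continuous near the identity,
  \<open>\<theta>\<close> being a homeomorphism between open subgroups (\<open>ex1_group_topology\<close>, \<open>conj_nbhd_one\<close>). The
  endomorphism comes from the universal property (\<open>hnn_lift\<close>).
\<close>

section \<open>Cosets\<close>

lemma (in group) mult_inv_cancel:
  assumes "x \<in> carrier G" "y \<in> carrier G"
  shows "x \<otimes> (inv x \<otimes> y) = y" "inv x \<otimes> (x \<otimes> y) = y"
  using assms by (simp_all flip: m_assoc)

lemma (in group) hom_funpow:
  assumes "\<alpha> \<in> hom G G"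
  shows "\<alpha> ^^ n \<in> hom G G"
proof (induction n)
  case (Suc n)
  then show ?case using assms by (simp add: hom_def Pi_iff)
qed (simp add: hom_def)

lemma (in group) rcos_eq_iff:
  assumes H: "subgroup H G" and x: "x \<in> carrier G" and y: "y \<in> carrier G"
  shows "H #> x = H #> y \<longleftrightarrow> x \<otimes> inv y \<in> H"
proof
  assume "H #> x = H #> y"
  then have "x \<in> H #> y" using rcos_self[OF x H] by simp
  then show "x \<otimes> inv y \<in> H" using subgroup.rcos_module_imp[OF H is_group y] by simp
next
  assume "x \<otimes> inv y \<in> H"
  then have "x \<in> H #> y" using subgroup.rcos_module_rev[OF H is_group y x] by simp
  then show "H #> x = H #> y" using repr_independence[OF _ y H] by simp
qed

lemma (in group) transversal_exists:
  assumes "subgroup H G"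
  obtains R where "R \<subseteq> carrier G" "card R = card (rcosets H)"
    and "\<And>x. x \<in> carrier G \<Longrightarrow> \<exists>r\<in>R. x \<otimes> inv r \<in> H"
    and "\<And>r r'. \<lbrakk>r \<in> R; r' \<in> R; r \<otimes> inv r' \<in> H\<rbrakk> \<Longrightarrow> r = r'"
proof -
  interpret H: subgroup H G by fact
  define c where "c C = (SOME x. x \<in> C)" for C :: "'a set"
  have c: "c C \<in> C" "c C \<in> carrier G" "H #> c C = C" if C: "C \<in> rcosets H" for C
  proof -
    obtain x where x: "x \<in> carrier G" "C = H #> x" using C by (auto simp: RCOSETS_def)
    have "x \<in> C" using x rcos_self[OF _ assms] by simp
    then show 1: "c C \<in> C" unfolding c_def by (rule someI)
    show 2: "c C \<in> carrier G" using 1 x H.subset r_coset_subset_G by blast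
    show "H #> c C = C" using 1 x repr_independence[OF _ x(1) assms] by simp
  qed
  have "inj_on c (rcosets H)" using c(3) by (metis inj_onI)
  show thesis
  proof
    show "c ` (rcosets H) \<subseteq> carrier G" using c(2) by auto
    show "card (c ` (rcosets H)) = card (rcosets H)" by (rule card_image) fact
    fix x assume x: "x \<in> carrier G"
    then have C: "H #> x \<in> rcosets H" by (auto simp: RCOSETS_def)
    have "x \<otimes> inv c (H #> x) \<in> H" using c[OF C] x by (simp flip: rcos_eq_iff[OF assms])
    then show "\<exists>r\<in>c ` (rcosets H). x \<otimes> inv r \<in> H" using C by blast
  next
    fix r r' assume "r \<in> c ` (rcosets H)" "r' \<in> c ` (rcosets H)" and rr: "r \<otimes> inv r' \<in> H"
    then obtain C C' where C: "C \<in> rcosets H" "r = c C" "C' \<in> rcosets H" "r' = c C'" by blast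
    then have "H #> r = H #> r'" using rr c(2) by (simp add: rcos_eq_iff[OF assms])
    then show "r = r'" using c(3) C by metis
  qed
qed

text \<open>Indices of subgroups of different groups are compared by exhibiting
  their cosets as the fibres of two maps on a common set.\<close>

lemma card_image_eq_if_same_fibres:
  assumes "\<And>x y. \<lbrakk>x \<in> X; y \<in> X\<rbrakk> \<Longrightarrow> f x = f y \<longleftrightarrow> g x = g y"
  shows "card (f ` X) = card (g ` X)"
proof (rule bij_betw_same_card[of "\<lambda>z. g (inv_into X f z)"])
  have inv: "inv_into X f (f x) \<in> X" "f (inv_into X f (f x)) = f x" if "x \<in> X" for x
    using that by (auto intro!: inv_into_into f_inv_into_f)
  have "g (inv_into X f (f x)) = g x" if "x \<in> X" for x
    using assms[OF inv(1) that] inv(2) that by blast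
  then show "bij_betw (\<lambda>z. g (inv_into X f z)) (f ` X) (g ` X)"
    unfolding bij_betw_def inj_on_def using assms by (auto simp: image_image)
qed

section \<open>HNN-extensions as groups\<close>

locale hnn_data = group B for B :: "('b, 'm) monoid_scheme" (structure) +
  fixes A :: "'b set" and \<theta> :: "'b \<Rightarrow> 'b"
  assumes A_subgroup: "subgroup A B"
    and theta_hom: "\<theta> \<in> hom (B\<lparr>carrier := A\<rparr>) B"
begin

abbreviation E where "E \<equiv> hnn_extension B A \<theta>"
abbreviation cls where "cls \<equiv> hnn_class B A \<theta>"
abbreviation cong_rel (infix "\<bumpeq>" 50) where "v \<bumpeq> w \<equiv> hnn_cong B A \<theta> v w"
abbreviation incl where "incl \<equiv> hnn_incl B A \<theta>"
abbreviation st where "st \<equiv> hnn_stable B A \<theta>"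

lemma theta_closed: "a \<in> A \<Longrightarrow> \<theta> a \<in> carrier B"
  using theta_hom by (auto simp: hom_def)

lemma A_carrier: "a \<in> A \<Longrightarrow> a \<in> carrier B"
  using A_subgroup by (rule subgroup.mem_carrier)

lemma hnn_words_simps [simp]:
  "[] \<in> hnn_words B"
  "Base b # w \<in> hnn_words B \<longleftrightarrow> b \<in> carrier B \<and> w \<in> hnn_words B"
  "Stable # w \<in> hnn_words B \<longleftrightarrow> w \<in> hnn_words B"
  "Stable_Inv # w \<in> hnn_words B \<longleftrightarrow> w \<in> hnn_words B"
  "v @ w \<in> hnn_words B \<longleftrightarrow> v \<in> hnn_words B \<and> w \<in> hnn_words B"
  by (auto simp: hnn_words_def)

lemma hnn_cong_words: "v \<bumpeq> w \<Longrightarrow> v \<in> hnn_words B \<and> w \<in> hnn_words B"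
  by (induction rule: hnn_cong.induct) (auto simp: theta_closed A_carrier)

lemma hnn_class_eq: "v \<bumpeq> w \<Longrightarrow> cls v = cls w"
  unfolding hnn_class_def by (blast intro: hnn_cong.sym hnn_cong.trans)

lemma hnn_class_self: "v \<in> hnn_words B \<Longrightarrow> v \<in> cls v"
  unfolding hnn_class_def by (simp add: hnn_cong.refl)

text \<open>The union that defines the product runs over equal sets, since the congruence is
  compatible with concatenation.\<close>

lemma hnn_class_mult:
  assumes "v \<in> hnn_words B" "w \<in> hnn_words B"
  shows "cls v \<otimes>\<^bsub>E\<^esub> cls w = cls (v @ w)"
proof -
  have "cls (v' @ w') = cls (v @ w)" if "v' \<in> cls v" "w' \<in> cls w" for v' w'
  proof -
    have "v \<bumpeq> v'" "w \<bumpeq> w'" using that by (auto simp: hnn_class_def)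
    then have "v @ w \<bumpeq> v' @ w'" by (rule hnn_cong.append)
    then show ?thesis by (rule hnn_class_eq[symmetric])
  qed
  then have "(\<Union>v'\<in>cls v. \<Union>w'\<in>cls w. cls (v' @ w')) = (\<Union>v'\<in>cls v. \<Union>w'\<in>cls w. cls (v @ w))"
    by (intro SUP_cong HOL.refl)
  also have "\<dots> = cls (v @ w)"
    using hnn_class_self[OF assms(1)] hnn_class_self[OF assms(2)] by blast
  finally show ?thesis by (simp add: hnn_extension_def)
qed

lemma hnn_one: "\<one>\<^bsub>E\<^esub> = cls []"
  by (simp add: hnn_extension_def)

lemma hnn_carrier: "carrier E = cls ` hnn_words B"
  by (simp add: hnn_extension_def)

lemma hnn_class_closed: "w \<in> hnn_words B \<Longrightarrow> cls w \<in> carrier E"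
  by (simp add: hnn_carrier)

text \<open>Words are inverted by induction: the inverse of the first letter is appended to a left
  inverse of the rest. This makes the quotient monoid a group.\<close>

lemma hnn_left_inverse:
  assumes "w \<in> hnn_words B"
  shows "\<exists>v\<in>hnn_words B. v @ w \<bumpeq> []"
  using assms
proof (induction w)
  case Nil
  show ?case by (rule bexI[of _ "[]"]) (auto intro: hnn_cong.refl)
next
  case (Cons l w)
  have w: "w \<in> hnn_words B" using Cons.prems by (cases l) auto
  then obtain v where v: "v \<in> hnn_words B" "v @ w \<bumpeq> []" using Cons.IH by blast
  have "\<exists>l'. [l'] \<in> hnn_words B \<and> [l', l] \<bumpeq> []"
  proof (cases l)
    case (Base b)
    then have b: "b \<in> carrier B" using Cons.prems by simp
    have "[Base (inv b), Base b] \<bumpeq> [Base \<one>]"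
      using hnn_cong.base_mult[of "inv b" B b A \<theta>] b by simp
    then show ?thesis using Base b
      by (intro exI[of _ "Base (inv b)"]) (simp add: hnn_cong.trans[OF _ hnn_cong.base_one])
  next
    case Stable
    then show ?thesis by (intro exI[of _ Stable_Inv]) (auto intro: hnn_cong.cancel_left)
  next
    case Stable_Inv
    then show ?thesis by (intro exI[of _ Stable]) (auto intro: hnn_cong.cancel_right)
  qed
  then obtain l' where l': "[l'] \<in> hnn_words B" "[l', l] \<bumpeq> []" by blast
  have "[l', l] @ w \<bumpeq> [] @ w" using l'(2) w by (intro hnn_cong.append hnn_cong.refl)
  then have "v @ ([l', l] @ w) \<bumpeq> v @ ([] @ w)"
    by (rule hnn_cong.append[OF hnn_cong.refl[OF v(1)]])
  then have "(v @ [l']) @ (l # w) \<bumpeq> []" using hnn_cong.trans[OF _ v(2)] by simp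
  then show ?case using v(1) l'(1) hnn_words_simps(5) by blast
qed

lemma hnn_group: "group E"
proof (rule groupI)
  fix x y z assume "x \<in> carrier E" "y \<in> carrier E" "z \<in> carrier E"
  then show "x \<otimes>\<^bsub>E\<^esub> y \<otimes>\<^bsub>E\<^esub> z = x \<otimes>\<^bsub>E\<^esub> (y \<otimes>\<^bsub>E\<^esub> z)"
    by (auto simp: hnn_carrier hnn_class_mult)
next
  fix x assume "x \<in> carrier E"
  then obtain w where w: "w \<in> hnn_words B" "x = cls w" by (auto simp: hnn_carrier)
  obtain v where v: "v \<in> hnn_words B" "v @ w \<bumpeq> []" using hnn_left_inverse[OF w(1)] by blast
  then show "\<exists>y\<in>carrier E. y \<otimes>\<^bsub>E\<^esub> x = \<one>\<^bsub>E\<^esub>"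
    using w hnn_class_eq[OF v(2)] by (intro bexI[of _ "cls v"]) (simp_all add: hnn_carrier hnn_class_mult hnn_one)
qed (use hnn_class_closed[of "[]"] in \<open>auto simp: hnn_carrier hnn_class_mult hnn_one\<close>)

sublocale E: group E by (rule hnn_group)

lemma incl_hom: "incl \<in> hom B E"
proof (rule homI)
  fix a b assume "a \<in> carrier B" "b \<in> carrier B"
  then show "incl (a \<otimes> b) = incl a \<otimes>\<^bsub>E\<^esub> incl b"
    using hnn_class_eq[OF hnn_cong.base_mult[of a B b A \<theta>]]
    by (simp add: hnn_incl_def hnn_class_mult)
qed (simp add: hnn_incl_def hnn_class_closed)

sublocale incl: group_hom B E incl
  using incl_hom by unfold_locales

lemma stable_closed [simp]: "st \<in> carrier E"
  by (simp add: hnn_stable_def hnn_class_closed)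

lemma stable_inv: "inv\<^bsub>E\<^esub> st = cls [Stable_Inv]"
proof (rule E.inv_equality)
  show "cls [Stable_Inv] \<otimes>\<^bsub>E\<^esub> st = \<one>\<^bsub>E\<^esub>"
    using hnn_class_eq[OF hnn_cong.cancel_left[of B A \<theta>]]
    by (simp add: hnn_stable_def hnn_class_mult hnn_one)
qed (simp_all add: hnn_class_closed)

lemma stable_conj: "a \<in> A \<Longrightarrow> inv\<^bsub>E\<^esub> st \<otimes>\<^bsub>E\<^esub> incl a \<otimes>\<^bsub>E\<^esub> st = incl (\<theta> a)"
  using hnn_class_eq[OF hnn_cong.stable[of a A B \<theta>]] A_carrier[of a]
  unfolding stable_inv by (simp add: hnn_stable_def hnn_incl_def hnn_class_mult)

lemma stable_conj':
  assumes "a \<in> A" shows "st \<otimes>\<^bsub>E\<^esub> incl (\<theta> a) \<otimes>\<^bsub>E\<^esub> inv\<^bsub>E\<^esub> st = incl a"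
proof -
  have "st \<otimes>\<^bsub>E\<^esub> incl (\<theta> a) = incl a \<otimes>\<^bsub>E\<^esub> st"
    unfolding stable_conj[OF assms, symmetric]
    using A_carrier[OF assms] by (simp add: E.m_assoc E.mult_inv_cancel)
  then show ?thesis using A_carrier[OF assms] by (simp add: E.m_assoc)
qed

text \<open>The neutral element has no case of its own: it is the image of the one of the base group.\<close>

lemma hnn_induct [consumes 1, case_names base stable stable_inv mult]:
  assumes "x \<in> carrier E"
    and base: "\<And>b. b \<in> carrier B \<Longrightarrow> P (incl b)"
    and stable: "P st" and stable': "P (inv\<^bsub>E\<^esub> st)"
    and mult: "\<And>x y. \<lbrakk>x \<in> carrier E; y \<in> carrier E; P x; P y\<rbrakk> \<Longrightarrow> P (x \<otimes>\<^bsub>E\<^esub> y)"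
  shows "P x"
proof -
  have "P (cls w)" if "w \<in> hnn_words B" for w
    using that
  proof (induction w)
    case Nil
    then show ?case using base[of \<one>] by (simp flip: hnn_one)
  next
    case (Cons l w)
    then have w: "[l] \<in> hnn_words B" "w \<in> hnn_words B" by (cases l; auto)+
    have "P (cls [l])"
    proof (cases l)
      case (Base b)
      then show ?thesis using w(1) base[of b] by (simp add: hnn_incl_def)
    next
      case Stable
      then show ?thesis using stable by (simp add: hnn_stable_def)
    next
      case Stable_Inv
      then show ?thesis using stable' by (simp add: stable_inv)
    qed
    then show ?case
      using mult[of "cls [l]" "cls w"] Cons.IH w hnn_class_mult[OF w]
      by (simp add: hnn_class_closed)
  qed
  then show ?thesis using assms(1) by (auto simp: hnn_carrier)
qed

lemma hnn_hom_unique: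
  assumes "group K" "F \<in> hom E K" "F' \<in> hom E K"
    and "\<And>b. b \<in> carrier B \<Longrightarrow> F (incl b) = F' (incl b)" "F st = F' st"
    and "x \<in> carrier E"
  shows "F x = F' x"
proof -
  interpret F: group_hom E K F using assms(1,2) E.group_axioms
    by (simp add: group_hom_def group_hom_axioms_def)
  interpret F': group_hom E K F' using assms(1,3) E.group_axioms
    by (simp add: group_hom_def group_hom_axioms_def)
  show ?thesis using assms(6)
    by (induction rule: hnn_induct) (auto simp: assms(4,5))
qed

end

subsection \<open>The universal property\<close>

primrec hnn_letter_value ::
    "('k, 'n) monoid_scheme \<Rightarrow> ('b \<Rightarrow> 'k) \<Rightarrow> 'k \<Rightarrow> 'b hnn_letter \<Rightarrow> 'k" where
  "hnn_letter_value K f \<tau> (Base b) = f b"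
| "hnn_letter_value K f \<tau> Stable = \<tau>"
| "hnn_letter_value K f \<tau> Stable_Inv = inv\<^bsub>K\<^esub> \<tau>"

primrec hnn_word_value ::
    "('k, 'n) monoid_scheme \<Rightarrow> ('b \<Rightarrow> 'k) \<Rightarrow> 'k \<Rightarrow> 'b hnn_letter list \<Rightarrow> 'k" where
  "hnn_word_value K f \<tau> [] = \<one>\<^bsub>K\<^esub>"
| "hnn_word_value K f \<tau> (l # w) = hnn_letter_value K f \<tau> l \<otimes>\<^bsub>K\<^esub> hnn_word_value K f \<tau> w"

context hnn_data
begin

text \<open>The value of a word in \<open>K\<close> is invariant under each relation that generates the congruence,
  hence a function of the class.\<close>

lemma hnn_lift:
  assumes "group K" "f \<in> hom B K" "\<tau> \<in> carrier K"
    and rel: "\<And>a. a \<in> A \<Longrightarrow> inv\<^bsub>K\<^esub> \<tau> \<otimes>\<^bsub>K\<^esub> f a \<otimes>\<^bsub>K\<^esub> \<tau> = f (\<theta> a)"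
  obtains F where "F \<in> hom E K" "\<And>b. b \<in> carrier B \<Longrightarrow> F (incl b) = f b" "F st = \<tau>"
proof -
  interpret K: group K by fact
  interpret f: group_hom B K f using assms(1,2) by unfold_locales
  let ?v = "hnn_word_value K f \<tau>"
  have letter: "hnn_letter_value K f \<tau> l \<in> carrier K" if "[l] \<in> hnn_words B" for l
    using that assms(3) by (cases l) auto
  have closed: "?v w \<in> carrier K" if "w \<in> hnn_words B" for w
    using that assms(3) letter
  proof (induction w)
    case (Cons l w) then show ?case by (cases l) auto
  qed auto
  have app: "?v (v @ w) = ?v v \<otimes>\<^bsub>K\<^esub> ?v w" if "v \<in> hnn_words B" "w \<in> hnn_words B" for v w
    using that
  proof (induction v)
    case (Cons l v)
    then have "v \<in> hnn_words B" "[l] \<in> hnn_words B" by (cases l; auto)+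
    then show ?case using Cons closed letter by (simp add: K.m_assoc)
  qed (simp add: closed)
  have cong: "?v v = ?v w" if "v \<bumpeq> w" for v w
    using that
  proof (induction rule: hnn_cong.induct)
    case (append v v' w w')
    then show ?case using hnn_cong_words[OF append.hyps(1)] hnn_cong_words[OF append.hyps(2)]
      by (simp add: app)
  next
    case (stable a)
    then show ?case using rel[of a] assms(3) A_carrier[of a] theta_closed[of a]
      by (simp add: K.m_assoc)
  qed (use assms(3) in auto)
  define F where "F X = ?v (SOME v. v \<in> X)" for X
  have F: "F (cls w) = ?v w" if "w \<in> hnn_words B" for w
  proof -
    have "(SOME v. v \<in> cls w) \<in> cls w" using hnn_class_self[OF that] by (rule someI)
    then show ?thesis unfolding F_def using cong by (auto simp: hnn_class_def)
  qed
  show thesis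
  proof
    show "F \<in> hom E K"
      by (rule homI) (auto simp: hnn_carrier hnn_class_mult F app closed)
    show "F (incl b) = f b" if "b \<in> carrier B" for b
      using that by (simp add: hnn_incl_def F)
    show "F st = \<tau>" using assms(3) by (simp add: hnn_stable_def F)
  qed
qed

end

section \<open>Realising an injective endomorphism as a conjugation\<close>

text \<open>The extension of \<open>G\<close> by a letter that induces \<open>\<phi>\<close> contains \<open>G\<close>, and a faithful permutation
  representation shows it. If \<open>R\<close> is a transversal of the right cosets of \<open>\<phi>(G)\<close>, then
  \<open>(h, r) \<mapsto> \<phi>(h) r\<close> is a bijection from \<open>G \<times> R\<close> to \<open>G\<close>. Let \<open>G\<close> act on the first factor of
  \<open>G \<times> R\<^sup>\<nat>\<close> by left translation. The map \<open>\<sigma>\<close> that moves the first entry of the sequence into the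
  group component, \<open>(h, r\<^sub>0 r\<^sub>1 r\<^sub>2 \<dots>) \<mapsto> (\<phi>(h) r\<^sub>0, r\<^sub>1 r\<^sub>2 \<dots>)\<close>, is then a permutation, and
  it turns translation by \<open>g\<close> into translation by \<open>\<phi>(g)\<close>. The sequences are there to absorb the
  factor \<open>R\<close>.\<close>

lemma (in group) endomorphism_as_conjugation:
  assumes "\<phi> \<in> hom G G" "inj_on \<phi> (carrier G)"
  obtains K :: "('a \<times> (nat \<Rightarrow> 'a) \<Rightarrow> 'a \<times> (nat \<Rightarrow> 'a)) monoid" and \<iota> \<sigma>
  where "group K" "\<iota> \<in> hom G K" "inj_on \<iota> (carrier G)" "\<sigma> \<in> carrier K"
    and "\<And>g. g \<in> carrier G \<Longrightarrow> \<sigma> \<otimes>\<^bsub>K\<^esub> \<iota> g \<otimes>\<^bsub>K\<^esub> inv\<^bsub>K\<^esub> \<sigma> = \<iota> (\<phi> g)"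
proof -
  interpret \<phi>: group_hom G G \<phi> using assms(1) by unfold_locales
  obtain R where R: "R \<subseteq> carrier G" 
    and Rex: "\<And>x. x \<in> carrier G \<Longrightarrow> \<exists>r\<in>R. x \<otimes> inv r \<in> \<phi> ` carrier G"
    and Runique: "\<And>r r'. \<lbrakk>r \<in> R; r' \<in> R; r \<otimes> inv r' \<in> \<phi> ` carrier G\<rbrakk> \<Longrightarrow> r = r'"
    using transversal_exists[OF \<phi>.img_is_subgroup] by metis
  define X where "X = carrier G \<times> (UNIV \<rightarrow> R :: (nat \<Rightarrow> 'a) set)"
  define K where "K = BijGroup X"
  define \<iota> where "\<iota> g = (\<lambda>(h, z)\<in>X. (g \<otimes> h, z))" for g
  define \<sigma> where "\<sigma> = (\<lambda>(h, z)\<in>X. (\<phi> h \<otimes> z 0, \<lambda>n. z (Suc n)))"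
  interpret K: group K unfolding K_def by (rule group_BijGroup)
  have Kc: "carrier K = Bij X" by (simp add: K_def BijGroup_def)
  have Km: "f \<otimes>\<^bsub>K\<^esub> g = compose X f g" if "f \<in> Bij X" "g \<in> Bij X" for f g
    using that by (simp add: K_def BijGroup_def)
  have \<iota>_app: "\<iota> g (h, z) = (g \<otimes> h, z)" if "(h, z) \<in> X" for g h z
    using that by (simp add: \<iota>_def)
  have \<sigma>_app: "\<sigma> (h, z) = (\<phi> h \<otimes> z 0, \<lambda>n. z (Suc n))" if "(h, z) \<in> X" for h z
    using that by (simp add: \<sigma>_def)
  have \<iota>_map: "\<iota> g x \<in> X" if "g \<in> carrier G" "x \<in> X" for g x
    using that by (auto simp: \<iota>_def X_def)
  have \<sigma>_map: "\<sigma> x \<in> X" if "x \<in> X" for x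
    using that R by (auto simp: \<sigma>_def X_def Pi_iff subset_eq)
  have \<iota>_mult: "compose X (\<iota> g) (\<iota> g') = \<iota> (g \<otimes> g')" if "g \<in> carrier G" "g' \<in> carrier G" for g g'
  proof (rule extensionalityI[where A = X])
    fix x assume x: "x \<in> X"
    obtain h z where hz: "x = (h, z)" by (cases x)
    then have h: "h \<in> carrier G" "(g' \<otimes> h, z) \<in> X" using x that by (auto simp: X_def)
    show "compose X (\<iota> g) (\<iota> g') x = \<iota> (g \<otimes> g') x"
      using x h that by (simp add: hz compose_def \<iota>_app m_assoc)
  qed (auto simp: \<iota>_def compose_def)
  have \<iota>_one: "\<iota> \<one> x = x" if "x \<in> X" for x
    using that by (auto simp: \<iota>_def X_def)
  have \<iota>_Bij: "\<iota> g \<in> Bij X" if g: "g \<in> carrier G" for g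
  proof -
    have "\<iota> g (\<iota> (inv g) x) = x \<and> \<iota> (inv g) (\<iota> g x) = x" if "x \<in> X" for x
      using fun_cong[OF \<iota>_mult[of g "inv g"], of x] fun_cong[OF \<iota>_mult[of "inv g" g], of x] g that \<iota>_one
      by (simp add: compose_def)
    then have "bij_betw (\<iota> g) X X"
      using g \<iota>_map by (intro bij_betw_byWitness[where f' = "\<iota> (inv g)"]) auto
    then show ?thesis by (simp add: Bij_def \<iota>_def)
  qed
  have \<sigma>_Bij: "\<sigma> \<in> Bij X"
  proof -
    have "inj_on \<sigma> X"
    proof (rule inj_onI)
      fix x y assume xy: "x \<in> X" "y \<in> X" "\<sigma> x = \<sigma> y"
      obtain h z h' z' where hz: "x = (h, z)" "y = (h', z')" by (cases x, cases y)
      have c: "h \<in> carrier G" "h' \<in> carrier G" "z 0 \<in> R" "z' 0 \<in> R"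
        using xy hz by (auto simp: X_def)
      then have c': "z 0 \<in> carrier G" "z' 0 \<in> carrier G" using R by auto
      have eq: "\<phi> h \<otimes> z 0 = \<phi> h' \<otimes> z' 0" and suc: "\<And>n. z (Suc n) = z' (Suc n)"
        using xy(3) \<sigma>_app xy(1,2) by (auto simp: hz dest: fun_cong)
      have "z 0 \<otimes> inv z' 0 = \<phi> (inv h \<otimes> h')"
      proof -
        have "z 0 = inv \<phi> h \<otimes> (\<phi> h' \<otimes> z' 0)" using eq c c' by (simp add: inv_solve_left)
        then show ?thesis using c c' by (simp add: m_assoc)
      qed
      then have z0: "z 0 = z' 0" using c Runique[of "z 0" "z' 0"] by (simp del: \<phi>.hom_mult)
      then have "\<phi> h = \<phi> h'" using eq c c' by simp
      then have "h = h'" using c assms(2) by (simp add: inj_on_eq_iff)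
      moreover have "z = z'"
      proof
        fix n show "z n = z' n" using z0 suc by (cases n) auto
      qed
      ultimately show "x = y" using hz by simp
    qed
    moreover have "y \<in> \<sigma> ` X" if "y \<in> X" for y
    proof -
      obtain k w where y: "y = (k, w)" by (cases y)
      have k: "k \<in> carrier G" "\<And>n. w n \<in> R" using that y by (auto simp: X_def)
      obtain r h where r: "r \<in> R" "h \<in> carrier G" "k \<otimes> inv r = \<phi> h" using Rex[OF k(1)] by blast
      have r': "r \<in> carrier G" using r R by auto
      have "k = \<phi> h \<otimes> r" using r' k by (simp add: m_assoc flip: r(3))
      moreover have x: "(h, case_nat r w) \<in> X" using r k by (auto simp: X_def split: nat.splits)
      ultimately have "\<sigma> (h, case_nat r w) = y" by (simp add: \<sigma>_app y)
      then show ?thesis using x by blast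
    qed
    ultimately have "bij_betw \<sigma> X X" using \<sigma>_map by (auto simp: bij_betw_def)
    then show ?thesis by (simp add: Bij_def \<sigma>_def)
  qed
  have comm: "\<sigma> \<otimes>\<^bsub>K\<^esub> \<iota> g = \<iota> (\<phi> g) \<otimes>\<^bsub>K\<^esub> \<sigma>" if g: "g \<in> carrier G" for g
  proof -
    have "compose X \<sigma> (\<iota> g) = compose X (\<iota> (\<phi> g)) \<sigma>"
    proof (rule extensionalityI[where A = X])
      fix x assume x: "x \<in> X"
      obtain h z where hz: "x = (h, z)" by (cases x)
      have h: "h \<in> carrier G" "z 0 \<in> carrier G" using x hz R by (auto simp: X_def)
      have "(g \<otimes> h, z) \<in> X" "(\<phi> h \<otimes> z 0, \<lambda>n. z (Suc n)) \<in> X" 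
        using x hz g R h by (auto simp: X_def)
      then show "compose X \<sigma> (\<iota> g) x = compose X (\<iota> (\<phi> g)) \<sigma> x"
        using x h g by (simp add: hz compose_def \<iota>_app \<sigma>_app m_assoc)
    qed (auto simp: compose_def)
    then show ?thesis using \<iota>_Bij \<sigma>_Bij g by (simp add: Km)
  qed
  have \<iota>K: "\<iota> g \<in> carrier K" if "g \<in> carrier G" for g using that \<iota>_Bij Kc by simp
  show thesis
  proof
    show "group K" by (rule K.is_group)
    show "\<iota> \<in> hom G K" by (rule homI) (simp_all add: Kc \<iota>_Bij Km \<iota>_mult)
    show "inj_on \<iota> (carrier G)"
    proof (rule inj_onI)
      fix g g' assume g: "g \<in> carrier G" "g' \<in> carrier G" "\<iota> g = \<iota> g'"
      obtain r where "r \<in> R" using Rex[OF one_closed] by blast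
      then have "(\<one>, \<lambda>_. r) \<in> X" by (simp add: X_def)
      then show "g = g'" using g \<iota>_app[of \<one> "\<lambda>_. r"] by (metis Pair_inject r_one)
    qed
    show \<sigma>K: "\<sigma> \<in> carrier K" by (simp add: Kc \<sigma>_Bij)
    fix g assume g: "g \<in> carrier G"
    show "\<sigma> \<otimes>\<^bsub>K\<^esub> \<iota> g \<otimes>\<^bsub>K\<^esub> inv\<^bsub>K\<^esub> \<sigma> = \<iota> (\<phi> g)"
      using comm[OF g] \<iota>K[of "\<phi> g"] \<sigma>K g by (simp add: K.m_assoc)
  qed
qed

section \<open>Topological groups\<close>

locale top_group = group G for G :: "('a, 'm) monoid_scheme" (structure) +
  fixes T :: "'a topology"
  assumes topological_group: "topological_group G T"
begin

lemma topspace_eq: "topspace T = carrier G"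
  using topological_group by (simp add: topological_group_def)

lemma openin_carrier: "openin T V \<Longrightarrow> V \<subseteq> carrier G"
  using openin_subset topspace_eq by metis

lemma continuous_map_mult:
  assumes "continuous_map X T f" "continuous_map X T g"
  shows "continuous_map X T (\<lambda>x. f x \<otimes> g x)"
proof -
  have "continuous_map X (prod_topology T T) (\<lambda>x. (f x, g x))"
    using assms by (simp add: continuous_map_pairwise o_def)
  moreover have "continuous_map (prod_topology T T) T (\<lambda>(x, y). x \<otimes> y)"
    using topological_group by (simp add: topological_group_def)
  ultimately show ?thesis using continuous_map_compose by (force simp: o_def)
qed

lemma continuous_map_inv:
  "continuous_map X T f \<Longrightarrow> continuous_map X T (\<lambda>x. inv (f x))"
  using topological_group continuous_map_compose[of X T f T "\<lambda>x. inv x"]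
  by (simp add: topological_group_def o_def)

lemma openin_preimage:
  "continuous_map T T f \<Longrightarrow> openin T V \<Longrightarrow> openin T {x \<in> carrier G. f x \<in> V}"
  using openin_continuous_map_preimage topspace_eq by metis

lemma openin_left_translate:
  assumes "openin T V" "a \<in> carrier G"
  shows "openin T ((\<lambda>x. a \<otimes> x) ` V)"
proof -
  have "(\<lambda>x. a \<otimes> x) ` V = {x \<in> carrier G. inv a \<otimes> x \<in> V}"
    using openin_carrier[OF assms(1)] assms(2)
    by (auto simp: subset_eq mult_inv_cancel intro!: rev_image_eqI)
  moreover have "continuous_map T T (\<lambda>x. inv a \<otimes> x)"
    using assms(2) topspace_eq by (intro continuous_map_mult) auto
  ultimately show ?thesis using openin_preimage assms(1) by simp
qed

lemma openin_r_coset: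
  assumes "openin T V" "a \<in> carrier G"
  shows "openin T (V #> a)"
proof -
  have V: "x \<in> carrier G" if "x \<in> V" for x using that openin_carrier[OF assms(1)] by auto
  have "V #> a = {x \<in> carrier G. x \<otimes> inv a \<in> V}"
  proof (intro equalityI subsetI)
    fix x assume "x \<in> {x \<in> carrier G. x \<otimes> inv a \<in> V}"
    then show "x \<in> V #> a" using assms(2) unfolding r_coset_def
      by (auto simp: m_assoc intro!: bexI[of _ "x \<otimes> inv a"])
  qed (use assms(2) V in \<open>auto simp: r_coset_def m_assoc\<close>)
  moreover have "continuous_map T T (\<lambda>x. x \<otimes> inv a)"
    using assms(2) topspace_eq by (intro continuous_map_mult) auto
  ultimately show ?thesis using openin_preimage assms(1) by simp
qed

lemma mult_nbhd_one:
  assumes "openin T Q" "\<one> \<in> Q"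
  obtains P where "openin T P" "\<one> \<in> P" "\<And>x y. \<lbrakk>x \<in> P; y \<in> P\<rbrakk> \<Longrightarrow> x \<otimes> y \<in> Q"
proof -
  let ?M = "{z \<in> topspace (prod_topology T T). (case z of (x, y) \<Rightarrow> x \<otimes> y) \<in> Q}"
  have "openin (prod_topology T T) ?M"
    using topological_group assms(1) 
    by (intro openin_continuous_map_preimage) (auto simp: topological_group_def)
  moreover have "(\<one>, \<one>) \<in> ?M" using assms by (simp add: topspace_eq)
  ultimately obtain V W where VW: "openin T V" "openin T W" "\<one> \<in> V" "\<one> \<in> W" "V \<times> W \<subseteq> ?M"
    unfolding openin_prod_topology_alt by meson
  show thesis
  proof
    show "openin T (V \<inter> W)" "\<one> \<in> V \<inter> W" using VW by auto
    show "x \<otimes> y \<in> Q" if "x \<in> V \<inter> W" "y \<in> V \<inter> W" for x y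
    proof -
      have "(x, y) \<in> ?M" using VW(5) that by (intro subsetD[OF VW(5)]) simp
      then show ?thesis by simp
    qed
  qed
qed

text \<open>A point \<open>x\<close> outside \<open>H\<close> either has the neighbourhood \<open>xU\<close> disjoint from \<open>H\<close>, or some \<open>xu\<close> lies in
  \<open>H\<close>; then \<open>x\<close> lies in \<open>xu(U - H)\<close>, which is open because \<open>H \<inter> U\<close> is closed.\<close>

lemma closedin_if_locally_closed_subgroup:
  assumes "subgroup U G" "openin T U" "subgroup H G" "closedin T (H \<inter> U)"
  shows "closedin T H"
proof -
  interpret U: subgroup U G by fact
  interpret H: subgroup H G by fact
  have "\<exists>W. openin T W \<and> x \<in> W \<and> W \<subseteq> carrier G - H" if x: "x \<in> carrier G" "x \<notin> H" for x
  proof (cases "\<exists>u\<in>U. x \<otimes> u \<in> H")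
    case False
    then show ?thesis using openin_left_translate[OF assms(2) x(1)] x(1) U.one_closed
      by (intro exI[of _ "(\<lambda>u. x \<otimes> u) ` U"]) (force intro: rev_image_eqI[of \<one>])
  next
    case True
    then obtain u where u: "u \<in> U" "x \<otimes> u \<in> H" by blast
    have uG: "u \<in> carrier G" using u by auto
    let ?W = "(\<lambda>y. (x \<otimes> u) \<otimes> y) ` (U - H \<inter> U)"
    have "inv u \<notin> H"
    proof
      assume "inv u \<in> H"
      then have "x \<otimes> u \<otimes> inv u \<in> H" using u by blast
      then show False using x uG by (simp add: m_assoc)
    qed
    then have "x \<in> ?W" using u x uG by (intro image_eqI[of _ _ "inv u"]) (auto simp: m_assoc)
    moreover have "openin T ?W"
      using assms(2,4) x uG by (intro openin_left_translate openin_diff) auto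
    moreover have "y \<notin> H" if y: "y \<in> ?W" for y
    proof
      obtain z where z: "z \<in> U" "z \<notin> H" "y = x \<otimes> u \<otimes> z" using y by auto
      assume "y \<in> H"
      then have "inv (x \<otimes> u) \<otimes> y \<in> H" using u by blast
      then show False using z x uG by (simp add: mult_inv_cancel)
    qed
    ultimately show ?thesis using openin_carrier[of ?W] by (intro exI[of _ ?W] conjI) (assumption, assumption, blast)
  qed
  then have "openin T (carrier G - H)" by (subst openin_subopen) blast
  then show ?thesis by (simp add: closedin_def topspace_eq H.subset)
qed

lemma closedin_open_subgroup:
  assumes "subgroup U G" "openin T U"
  shows "closedin T U"
proof -
  interpret U: subgroup U G by fact
  have "\<exists>W. openin T W \<and> x \<in> W \<and> W \<subseteq> carrier G - U" if x: "x \<in> carrier G - U" for x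
  proof (intro exI conjI)
    show "openin T (U #> x)" using assms x by (intro openin_r_coset) auto
    show "x \<in> U #> x" using x assms(1) by (intro rcos_self) auto
    show "U #> x \<subseteq> carrier G - U"
    proof
      fix y assume "y \<in> U #> x"
      then obtain u where u: "u \<in> U" "y = u \<otimes> x" by (auto simp: r_coset_def)
      have "x \<in> U" if "y \<in> U"
      proof -
        have "inv u \<otimes> y \<in> U" using that u by blast
        then show ?thesis using u x by (simp add: mult_inv_cancel)
      qed
      then show "y \<in> carrier G - U" using u x by auto
    qed
  qed
  then have "openin T (carrier G - U)" by (subst openin_subopen) blast
  then show ?thesis by (simp add: closedin_def topspace_eq U.subset)
qed

end

lemma topological_group_DirProd:
  assumes "topological_group G T" "topological_group H T'"
  shows "topological_group (G \<times>\<times> H) (prod_topology T T')"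
proof -
  interpret G: top_group G T using assms(1)
    by (simp add: top_group_def top_group_axioms_def topological_group_def)
  interpret H: top_group H T' using assms(2)
    by (simp add: top_group_def top_group_axioms_def topological_group_def)
  let ?S = "prod_topology T T'"
  have fs: "continuous_map ?S T fst" "continuous_map ?S T' snd"
    by (simp_all add: continuous_map_fst continuous_map_snd)
  have c: "continuous_map (prod_topology ?S ?S) T (\<lambda>z. fst (fst z))"
    "continuous_map (prod_topology ?S ?S) T (\<lambda>z. fst (snd z))"
    "continuous_map (prod_topology ?S ?S) T' (\<lambda>z. snd (fst z))"
    "continuous_map (prod_topology ?S ?S) T' (\<lambda>z. snd (snd z))"
    using continuous_map_compose[OF continuous_map_fst fs(1)]
      continuous_map_compose[OF continuous_map_snd fs(1)]
      continuous_map_compose[OF continuous_map_fst fs(2)]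
      continuous_map_compose[OF continuous_map_snd fs(2)] by (simp_all add: o_def)
  have "continuous_map (prod_topology ?S ?S) ?S (\<lambda>(x, y). x \<otimes>\<^bsub>G \<times>\<times> H\<^esub> y)"
    using G.continuous_map_mult[OF c(1,2)] H.continuous_map_mult[OF c(3,4)]
    by (simp add: continuous_map_pairwise o_def case_prod_unfold DirProd_def)
  moreover have "continuous_map ?S ?S (\<lambda>x. inv\<^bsub>G \<times>\<times> H\<^esub> x)"
  proof (rule continuous_map_eq)
    show "continuous_map ?S ?S (\<lambda>x. (inv\<^bsub>G\<^esub> fst x, inv\<^bsub>H\<^esub> snd x))"
      using G.continuous_map_inv[OF fs(1)] H.continuous_map_inv[OF fs(2)]
      by (simp add: continuous_map_pairwise o_def)
    show "(inv\<^bsub>G\<^esub> fst x, inv\<^bsub>H\<^esub> snd x) = inv\<^bsub>G \<times>\<times> H\<^esub> x" if "x \<in> topspace ?S" for x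
      using that G.topspace_eq H.topspace_eq
      by (auto simp: inv_DirProd[OF G.is_group H.is_group])
  qed
  ultimately show ?thesis
    using DirProd_group[OF G.is_group H.is_group] G.topspace_eq H.topspace_eq
    by (simp add: topological_group_def)
qed

lemma homeomorphic_map_prod:
  assumes "homeomorphic_map X X' f" "homeomorphic_map Y Y' g"
  shows "homeomorphic_map (prod_topology X Y) (prod_topology X' Y') (\<lambda>(x, y). (f x, g y))"
proof -
  obtain f' g' where "homeomorphic_maps X X' f f'" "homeomorphic_maps Y Y' g g'"
    using assms by (auto simp: homeomorphic_map_maps)
  then have "homeomorphic_maps (prod_topology X Y) (prod_topology X' Y')
      (\<lambda>(x, y). (f x, g y)) (\<lambda>(x, y). (f' x, g' y))"
    unfolding homeomorphic_maps_prod by blast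
  then show ?thesis by (simp add: homeomorphic_maps_map)
qed

lemma topological_iso_ontoD:
  assumes "topspace T = carrier G" "compact_open_subgroup G T H" "topological_iso_onto G T G T H \<phi>"
  shows "\<phi> \<in> hom G G" "inj_on \<phi> (carrier G)" "\<phi> ` carrier G = H"
    "homeomorphic_map T (subtopology T H) \<phi>" "continuous_map T T \<phi>"
    "homeomorphic_map (subtopology T H) T (inv_into (carrier G) \<phi>)"
proof -
  have iso: "\<phi> \<in> hom G (G\<lparr>carrier := H\<rparr>)" "bij_betw \<phi> (carrier G) H"
    and homeo: "homeomorphic_map T (subtopology T H) \<phi>"
    using assms(3) by (auto simp: topological_iso_onto_def iso_def)
  have H: "subgroup H G" using assms(2) by (simp add: compact_open_subgroup_def)
  show "\<phi> \<in> hom G G" using iso(1) subgroup.subset[OF H] by (auto simp: hom_def)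
  show inj: "inj_on \<phi> (carrier G)" and im: "\<phi> ` carrier G = H"
    using iso(2) by (auto simp: bij_betw_def)
  show "homeomorphic_map T (subtopology T H) \<phi>" by fact
  then show "continuous_map T T \<phi>"
    using homeomorphic_imp_continuous_map continuous_map_in_subtopology by blast
  obtain g where g: "homeomorphic_maps T (subtopology T H) \<phi> g"
    using homeo by (auto simp: homeomorphic_map_maps)
  then have "homeomorphic_map (subtopology T H) T g" by (simp add: homeomorphic_maps_map)
  moreover have "g y = inv_into (carrier G) \<phi> y" if "y \<in> topspace (subtopology T H)" for y
  proof -
    have "y \<in> H" using that by simp
    then obtain x where x: "x \<in> carrier G" "y = \<phi> x" using im by blast
    have "g y = x" using g x assms(1) by (simp add: homeomorphic_maps_map)
    then show ?thesis using x inj by simp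
  qed
  ultimately show "homeomorphic_map (subtopology T H) T (inv_into (carrier G) \<phi>)"
    using homeomorphic_map_eq by blast
qed

section \<open>Extending a group topology along a homomorphism\<close>

locale top_group_hom = top_group B S + group_hom B E f
  for B :: "('b, 'm) monoid_scheme" (structure) and S
    and E :: "('e, 'n) monoid_scheme" and f
begin

text \<open>Left translations are homeomorphisms, so if \<open>f\<close> is to be continuous and open, the sets \<open>v f(Q)\<close>,
  for \<open>Q\<close> a neighbourhood of the identity in \<open>B\<close>, must form a neighbourhood base at \<open>v\<close>.\<close>

definition translates_open :: "'e set \<Rightarrow> bool" where
  "translates_open V \<longleftrightarrow> V \<subseteq> carrier E \<and>
     (\<forall>v\<in>V. \<exists>Q. openin S Q \<and> \<one> \<in> Q \<and> (\<forall>q\<in>Q. v \<otimes>\<^bsub>E\<^esub> f q \<in> V))"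

lemma translates_openE:
  assumes "translates_open V" "v \<in> V"
  obtains Q where "openin S Q" "\<one> \<in> Q" "\<forall>q\<in>Q. v \<otimes>\<^bsub>E\<^esub> f q \<in> V"
  using assms unfolding translates_open_def by blast

lemma openin_iff_translates_open:
  assumes "topological_group E T" "continuous_map S T f" "open_map S T f"
  shows "openin T V \<longleftrightarrow> translates_open V"
proof
  interpret E: top_group E T using assms(1) H.is_group
    by (simp add: top_group_def top_group_axioms_def)
  {
    assume V: "openin T V"
    show "translates_open V" unfolding translates_open_def
    proof (intro conjI ballI)
      show VE: "V \<subseteq> carrier E" using E.openin_carrier[OF V] .
      fix v assume v: "v \<in> V"
      let ?Q = "{b \<in> topspace S. v \<otimes>\<^bsub>E\<^esub> f b \<in> V}"
      have "continuous_map S T (\<lambda>b. v \<otimes>\<^bsub>E\<^esub> f b)"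
        using v VE E.topspace_eq assms(2) by (intro E.continuous_map_mult) auto
      then have "openin S ?Q" using V by (rule openin_continuous_map_preimage)
      moreover have "\<one> \<in> ?Q" using v VE by (auto simp: topspace_eq)
      ultimately show "\<exists>Q. openin S Q \<and> \<one> \<in> Q \<and> (\<forall>q\<in>Q. v \<otimes>\<^bsub>E\<^esub> f q \<in> V)" by blast
    qed
  }
  {
    assume V: "translates_open V"
    have "\<exists>W. openin T W \<and> v \<in> W \<and> W \<subseteq> V" if v: "v \<in> V" for v
    proof -
      obtain Q where Q: "openin S Q" "\<one> \<in> Q" "\<forall>q\<in>Q. v \<otimes>\<^bsub>E\<^esub> f q \<in> V"
        using V v by (rule translates_openE)
      have vE: "v \<in> carrier E" using V v unfolding translates_open_def by blast
      let ?W = "(\<lambda>y. v \<otimes>\<^bsub>E\<^esub> y) ` f ` Q"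
      have "openin T (f ` Q)" using assms(3) Q(1) by (simp add: open_map_def)
      then have "openin T ?W" using vE by (rule E.openin_left_translate)
      moreover have "v \<in> ?W" using vE Q(2) by (force intro: rev_image_eqI)
      ultimately show ?thesis using Q(3) by blast
    qed
    then show "openin T V" by (subst openin_subopen) blast
  }
qed

text \<open>The image of \<open>f\<close> is an open subgroup, and continuity of a homomorphism is a matter of the
  neighbourhoods of the identity.\<close>

lemma continuous_hom_if_continuous_comp:
  assumes T: "topological_group E T" "continuous_map S T f" "open_map S T f"
    and T': "topological_group E' T'" and F: "F \<in> hom E E'"
    and cont: "continuous_map S T' (\<lambda>b. F (f b))"
  shows "continuous_map T T' F"
proof -
  interpret E: top_group E T using T(1) H.is_group
    by (simp add: top_group_def top_group_axioms_def)
  interpret E': top_group E' T' using T'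
    by (simp add: top_group_def top_group_axioms_def topological_group_def)
  interpret F: group_hom E E' F using F by unfold_locales
  have "openin T {x \<in> topspace T. F x \<in> V}" if V: "openin T' V" for V
    unfolding openin_iff_translates_open[OF T] translates_open_def
  proof (intro conjI ballI)
    fix x assume "x \<in> {x \<in> topspace T. F x \<in> V}"
    then have x: "x \<in> carrier E" "F x \<in> V" by (auto simp: E.topspace_eq)
    let ?Q = "{b \<in> topspace S. F x \<otimes>\<^bsub>E'\<^esub> F (f b) \<in> V}"
    have "continuous_map S T' (\<lambda>b. F x \<otimes>\<^bsub>E'\<^esub> F (f b))"
      using x E'.topspace_eq cont by (intro E'.continuous_map_mult) auto
    then have "openin S ?Q" using V by (rule openin_continuous_map_preimage)
    moreover have "\<one> \<in> ?Q" using x by (auto simp: topspace_eq)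
    ultimately show "\<exists>Q. openin S Q \<and> \<one> \<in> Q \<and> (\<forall>q\<in>Q. x \<otimes>\<^bsub>E\<^esub> f q \<in> {x \<in> topspace T. F x \<in> V})"
      using x by (intro exI[of _ ?Q]) (auto simp: topspace_eq E.topspace_eq)
  qed (auto simp: E.topspace_eq)
  then show ?thesis using E.topspace_eq E'.topspace_eq by (auto simp: continuous_map_def)
qed

text \<open>The only candidate is the topology of the sets with open translates. It makes left translations
  continuous by construction; the hypothesis, that conjugations are continuous at the identity
  along \<open>f\<close>, is what allows factors from \<open>f(B)\<close> to be moved past a group element and hence gives the
  continuity of multiplication and inversion.\<close>

lemma ex1_group_topology:
  assumes conj: "\<And>h P. \<lbrakk>h \<in> carrier E; openin S P; \<one> \<in> P\<rbrakk> \<Longrightarrow>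
    \<exists>Q. openin S Q \<and> \<one> \<in> Q \<and> (\<forall>q\<in>Q. \<exists>p\<in>P. h \<otimes>\<^bsub>E\<^esub> f q \<otimes>\<^bsub>E\<^esub> inv\<^bsub>E\<^esub> h = f p)"
  shows "\<exists>!T. topological_group E T \<and> continuous_map S T f \<and> open_map S T f"
proof (rule ex_ex1I)
  have "istopology translates_open"
    unfolding istopology_def
  proof (intro conjI allI impI)
    fix V W assume VW: "translates_open V" "translates_open W"
    show "translates_open (V \<inter> W)" unfolding translates_open_def
    proof (intro conjI ballI)
      fix v assume "v \<in> V \<inter> W"
      then have v: "v \<in> V" "v \<in> W" by simp_all
      obtain P where "openin S P \<and> \<one> \<in> P \<and> (\<forall>q\<in>P. v \<otimes>\<^bsub>E\<^esub> f q \<in> V)"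
        using VW(1) v(1) unfolding translates_open_def by blast
      moreover obtain Q where "openin S Q \<and> \<one> \<in> Q \<and> (\<forall>q\<in>Q. v \<otimes>\<^bsub>E\<^esub> f q \<in> W)"
        using VW(2) v(2) unfolding translates_open_def by blast
      ultimately show "\<exists>Q. openin S Q \<and> \<one> \<in> Q \<and> (\<forall>q\<in>Q. v \<otimes>\<^bsub>E\<^esub> f q \<in> V \<inter> W)"
        by (intro exI[of _ "P \<inter> Q"]) auto
    qed (use VW in \<open>auto simp: translates_open_def\<close>)
  next
    fix \<V> assume \<V>: "\<forall>V\<in>\<V>. translates_open V"
    show "translates_open (\<Union>\<V>)" unfolding translates_open_def
    proof (intro conjI ballI)
      fix v assume "v \<in> \<Union>\<V>"
      then obtain V where V: "V \<in> \<V>" "v \<in> V" by blast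
      then obtain Q where "openin S Q" "\<one> \<in> Q" "\<forall>q\<in>Q. v \<otimes>\<^bsub>E\<^esub> f q \<in> V"
        using translates_openE[OF bspec[OF \<V>]] by metis
      then show "\<exists>Q. openin S Q \<and> \<one> \<in> Q \<and> (\<forall>q\<in>Q. v \<otimes>\<^bsub>E\<^esub> f q \<in> \<Union>\<V>)"
        using V(1) by (intro exI[of _ Q]) auto
    qed (use \<V> in \<open>auto simp: translates_open_def\<close>)
  qed
  define T where "T = topology translates_open"
  have T: "openin T V \<longleftrightarrow> translates_open V" for V
    using \<open>istopology translates_open\<close> by (simp add: T_def topology_inverse')
  have top: "topspace T = carrier E"
  proof
    show "topspace T \<subseteq> carrier E"
      using openin_topspace[of T] unfolding T translates_open_def by blast
    have "translates_open (carrier E)" unfolding translates_open_def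
      using openin_topspace[of S] by (auto simp: topspace_eq intro!: exI[of _ "carrier B"])
    then show "carrier E \<subseteq> topspace T" by (simp add: openin_subset flip: T)
  qed
  have S_carrier: "x \<in> carrier B" if "x \<in> Q" "openin S Q" for x Q
    using that openin_carrier by blast
  have nbhd: "openin T ((\<lambda>q. v \<otimes>\<^bsub>E\<^esub> f q) ` Q)" if v: "v \<in> carrier E" and Q: "openin S Q" for v Q
    unfolding T translates_open_def
  proof (intro conjI ballI)
    fix y assume "y \<in> (\<lambda>q. v \<otimes>\<^bsub>E\<^esub> f q) ` Q"
    then obtain b where b: "b \<in> Q" "y = v \<otimes>\<^bsub>E\<^esub> f b" by blast
    have bB: "b \<in> carrier B" using b(1) Q by (rule S_carrier)
    have "openin S ((\<lambda>x. inv b \<otimes> x) ` Q)" using Q bB by (intro openin_left_translate) auto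
    moreover have "\<one> \<in> (\<lambda>x. inv b \<otimes> x) ` Q" using b bB by (force intro: rev_image_eqI)
    moreover have "y \<otimes>\<^bsub>E\<^esub> f (inv b \<otimes> q) = v \<otimes>\<^bsub>E\<^esub> f q" if "q \<in> Q" for q
      using S_carrier[OF that Q] bB v by (simp add: b H.m_assoc H.mult_inv_cancel)
    ultimately show "\<exists>P. openin S P \<and> \<one> \<in> P \<and> (\<forall>q\<in>P. y \<otimes>\<^bsub>E\<^esub> f q \<in> (\<lambda>q. v \<otimes>\<^bsub>E\<^esub> f q) ` Q)"
      by (intro exI[of _ "(\<lambda>x. inv b \<otimes> x) ` Q"]) auto
  qed (use v S_carrier[OF _ Q] in auto)
  have "continuous_map (prod_topology T T) T (\<lambda>(x, y). x \<otimes>\<^bsub>E\<^esub> y)"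
  proof -
    have "openin (prod_topology T T)
        {z \<in> topspace (prod_topology T T). (case z of (x, y) \<Rightarrow> x \<otimes>\<^bsub>E\<^esub> y) \<in> V}" (is "openin _ ?M")
      if V: "openin T V" for V
      unfolding openin_prod_topology_alt
    proof (intro allI impI)
      fix x y assume xy: "(x, y) \<in> ?M"
      then have E: "x \<in> carrier E" "y \<in> carrier E" "x \<otimes>\<^bsub>E\<^esub> y \<in> V" by (auto simp: top)
      then obtain Q where Q: "openin S Q" "\<one> \<in> Q" "\<forall>q\<in>Q. x \<otimes>\<^bsub>E\<^esub> y \<otimes>\<^bsub>E\<^esub> f q \<in> V"
        using V unfolding T by (auto elim: translates_openE)
      obtain Q' where Q': "openin S Q'" "\<one> \<in> Q'" "\<And>p q. \<lbrakk>p \<in> Q'; q \<in> Q'\<rbrakk> \<Longrightarrow> p \<otimes> q \<in> Q"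
        using mult_nbhd_one[OF Q(1,2)] by metis
      obtain P where P: "openin S P" "\<one> \<in> P"
        "\<And>q. q \<in> P \<Longrightarrow> \<exists>p\<in>Q'. inv\<^bsub>E\<^esub> y \<otimes>\<^bsub>E\<^esub> f q \<otimes>\<^bsub>E\<^esub> inv\<^bsub>E\<^esub> (inv\<^bsub>E\<^esub> y) = f p"
        using conj[OF H.inv_closed[OF E(2)] Q'(1,2)] by blast
      let ?X = "(\<lambda>q. x \<otimes>\<^bsub>E\<^esub> f q) ` P" and ?Y = "(\<lambda>q. y \<otimes>\<^bsub>E\<^esub> f q) ` Q'"
      have "x \<otimes>\<^bsub>E\<^esub> f p \<otimes>\<^bsub>E\<^esub> (y \<otimes>\<^bsub>E\<^esub> f q) \<in> V" if pq: "p \<in> P" "q \<in> Q'" for p q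
      proof -
        obtain p' where p': "p' \<in> Q'" "inv\<^bsub>E\<^esub> y \<otimes>\<^bsub>E\<^esub> f p \<otimes>\<^bsub>E\<^esub> y = f p'"
          using P(3)[OF pq(1)] E(2) by auto
        have B: "p \<in> carrier B" "p' \<in> carrier B" "q \<in> carrier B"
          using pq p' P(1) Q'(1) S_carrier by auto
        \<comment> \<open>\<open>x f(p) y f(q) = xy f(p') f(q)\<close> where \<open>p'q\<close> lies in \<open>Q\<close>\<close>
        have "f p \<otimes>\<^bsub>E\<^esub> y = y \<otimes>\<^bsub>E\<^esub> f p'" unfolding p'(2)[symmetric]
          using B E by (simp add: H.m_assoc H.mult_inv_cancel)
        then have "x \<otimes>\<^bsub>E\<^esub> f p \<otimes>\<^bsub>E\<^esub> (y \<otimes>\<^bsub>E\<^esub> f q) = x \<otimes>\<^bsub>E\<^esub> (y \<otimes>\<^bsub>E\<^esub> f p' \<otimes>\<^bsub>E\<^esub> f q)"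
          using B E by (simp add: H.m_assoc[symmetric]) (simp add: H.m_assoc)
        also have "\<dots> = x \<otimes>\<^bsub>E\<^esub> y \<otimes>\<^bsub>E\<^esub> f (p' \<otimes> q)" using B E by (simp add: H.m_assoc)
        finally show ?thesis using Q(3) Q'(3)[OF p'(1) pq(2)] by simp
      qed
      then have "?X \<times> ?Y \<subseteq> ?M"
        using E S_carrier[OF _ P(1)] S_carrier[OF _ Q'(1)] by (auto simp: top)
      moreover have "x \<in> ?X" "y \<in> ?Y" using E P(2) Q'(2) by (force intro: rev_image_eqI)+
      ultimately show "\<exists>X Y. openin T X \<and> openin T Y \<and> x \<in> X \<and> y \<in> Y \<and> X \<times> Y \<subseteq> ?M"
        using nbhd[OF E(1) P(1)] nbhd[OF E(2) Q'(1)] by blast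
    qed
    then show ?thesis by (auto simp: continuous_map_def top)
  qed
  moreover have "continuous_map T T (\<lambda>x. inv\<^bsub>E\<^esub> x)"
  proof -
    have "openin T {x \<in> topspace T. inv\<^bsub>E\<^esub> x \<in> V}" if V: "openin T V" for V
      unfolding T translates_open_def
    proof (intro conjI ballI)
      fix x assume "x \<in> {x \<in> topspace T. inv\<^bsub>E\<^esub> x \<in> V}"
      then have x: "x \<in> carrier E" "inv\<^bsub>E\<^esub> x \<in> V" by (auto simp: top)
      then obtain Q where Q: "openin S Q" "\<one> \<in> Q" "\<forall>q\<in>Q. inv\<^bsub>E\<^esub> x \<otimes>\<^bsub>E\<^esub> f q \<in> V"
        using V unfolding T by (auto elim: translates_openE)
      have "continuous_map S S (\<lambda>b. inv b)" by (rule continuous_map_inv) simp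
      then have iQ: "openin S {b \<in> carrier B. inv b \<in> Q}" using Q(1) by (rule openin_preimage)
      obtain P where P: "openin S P" "\<one> \<in> P"
        "\<And>q. q \<in> P \<Longrightarrow> \<exists>p\<in>{b \<in> carrier B. inv b \<in> Q}. x \<otimes>\<^bsub>E\<^esub> f q \<otimes>\<^bsub>E\<^esub> inv\<^bsub>E\<^esub> x = f p"
        using conj[OF x(1) iQ] Q(2) by auto
      have "inv\<^bsub>E\<^esub> (x \<otimes>\<^bsub>E\<^esub> f q) \<in> V" if q: "q \<in> P" for q
      proof -
        obtain p where p: "p \<in> carrier B" "inv p \<in> Q" "x \<otimes>\<^bsub>E\<^esub> f q \<otimes>\<^bsub>E\<^esub> inv\<^bsub>E\<^esub> x = f p"
          using P(3)[OF q] by blast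
        have qB: "q \<in> carrier B" using S_carrier[OF q P(1)] .
        have "x \<otimes>\<^bsub>E\<^esub> f q = f p \<otimes>\<^bsub>E\<^esub> x"
          unfolding p(3)[symmetric] using qB x by (simp add: H.m_assoc)
        then have "inv\<^bsub>E\<^esub> (x \<otimes>\<^bsub>E\<^esub> f q) = inv\<^bsub>E\<^esub> x \<otimes>\<^bsub>E\<^esub> f (inv p)"
          using p(1) x by (simp add: H.inv_mult_group)
        then show ?thesis using Q(3) p(2) by simp
      qed
      then show "\<exists>P. openin S P \<and> \<one> \<in> P \<and> (\<forall>q\<in>P. x \<otimes>\<^bsub>E\<^esub> f q \<in> {x \<in> topspace T. inv\<^bsub>E\<^esub> x \<in> V})"
        using P(1,2) x S_carrier[OF _ P(1)] by (intro exI[of _ P]) (auto simp: top)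
    qed (auto simp: top)
    then show ?thesis by (auto simp: continuous_map_def top)
  qed
  moreover have "continuous_map S T f"
  proof -
    have "openin S {b \<in> topspace S. f b \<in> V}" if V: "openin T V" for V
    proof (subst openin_subopen, intro ballI)
      fix b assume "b \<in> {b \<in> topspace S. f b \<in> V}"
      then have b: "b \<in> carrier B" "f b \<in> V" by (auto simp: topspace_eq)
      then obtain Q where Q: "openin S Q" "\<one> \<in> Q" "\<forall>q\<in>Q. f b \<otimes>\<^bsub>E\<^esub> f q \<in> V"
        using V unfolding T by (auto elim: translates_openE)
      have "b \<in> (\<lambda>q. b \<otimes> q) ` Q" using b Q(2) by (force intro: rev_image_eqI)
      moreover have "(\<lambda>q. b \<otimes> q) ` Q \<subseteq> {b \<in> topspace S. f b \<in> V}"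
        using Q(3) b S_carrier[OF _ Q(1)] by (auto simp: topspace_eq)
      ultimately show "\<exists>W. openin S W \<and> b \<in> W \<and> W \<subseteq> {b \<in> topspace S. f b \<in> V}"
        using openin_left_translate[OF Q(1) b(1)] by blast
    qed
    then show ?thesis by (auto simp: continuous_map_def top topspace_eq)
  qed
  moreover have "open_map S T f"
  proof -
    have "openin T (f ` Q)" if Q: "openin S Q" for Q
    proof -
      have "(\<lambda>q. \<one>\<^bsub>E\<^esub> \<otimes>\<^bsub>E\<^esub> f q) ` Q = f ` Q"
        using S_carrier[OF _ Q] by (intro image_cong) auto
      then show ?thesis using nbhd[OF H.one_closed Q] by simp
    qed
    then show ?thesis by (simp add: open_map_def)
  qed
  ultimately show "\<exists>T. topological_group E T \<and> continuous_map S T f \<and> open_map S T f"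
    using top H.is_group by (auto simp: topological_group_def)
next
  fix T T'
  assume "topological_group E T \<and> continuous_map S T f \<and> open_map S T f"
    "topological_group E T' \<and> continuous_map S T' f \<and> open_map S T' f"
  then show "T = T'" using openin_iff_translates_open by (metis topology_eq)
qed

end

section \<open>The topology of an HNN-extension\<close>

locale top_hnn_data = hnn_data B A \<theta> + top_group B S
  for B :: "('b, 'm) monoid_scheme" (structure) and S A \<theta> +
  assumes A_open: "openin S A"
    and theta_continuous: "continuous_map (subtopology S A) S \<theta>"
    and theta_open: "open_map (subtopology S A) S \<theta>"
begin

abbreviation \<T> where "\<T> \<equiv> hnn_topology B S A \<theta>"

lemma one_A: "\<one> \<in> A"
  using A_subgroup by (rule subgroup.one_closed)

lemma theta_one: "\<theta> \<one> = \<one>"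
proof -
  have "\<theta> \<one> \<otimes> \<theta> \<one> = \<theta> \<one>"
    using hom_mult[OF theta_hom, of \<one> \<one>] one_A by simp
  then show ?thesis using theta_closed[OF one_A] by simp
qed

text \<open>The elements \<open>h\<close> with this property are closed under products, so generators suffice. For the
  stable letter take \<open>Q = \<theta>(P \<inter> A)\<close>, open because \<open>\<theta>\<close> is an open map; for its inverse take
  \<open>Q = A \<inter> \<theta>\<inverse>(P)\<close>, open because \<open>\<theta>\<close> is continuous and \<open>A\<close> is open.\<close>

lemma conj_nbhd_one:
  assumes "h \<in> carrier E" "openin S P" "\<one> \<in> P"
  shows "\<exists>Q. openin S Q \<and> \<one> \<in> Q \<and>
    (\<forall>q\<in>Q. \<exists>p\<in>P. h \<otimes>\<^bsub>E\<^esub> incl q \<otimes>\<^bsub>E\<^esub> inv\<^bsub>E\<^esub> h = incl p)"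
  using assms
proof (induction arbitrary: P rule: hnn_induct)
  case (base b)
  let ?Q = "{c \<in> carrier B. b \<otimes> c \<otimes> inv b \<in> P}"
  have "continuous_map S S (\<lambda>c. b \<otimes> c \<otimes> inv b)"
    using base(1) topspace_eq by (intro continuous_map_mult) auto
  then have "openin S ?Q" using base(2) by (rule openin_preimage)
  moreover have "\<one> \<in> ?Q" using base by simp
  moreover have "incl b \<otimes>\<^bsub>E\<^esub> incl q \<otimes>\<^bsub>E\<^esub> inv\<^bsub>E\<^esub> incl b = incl (b \<otimes> q \<otimes> inv b)"
    if "q \<in> carrier B" for q using that base(1) by simp
  ultimately show ?case by (intro exI[of _ ?Q]) auto
next
  case stable
  let ?Q = "\<theta> ` (P \<inter> A)"
  have "openin (subtopology S A) (P \<inter> A)" using stable(1) by (rule openin_subtopology_Int)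
  then have "openin S ?Q" using theta_open by (simp add: open_map_def)
  moreover have "\<one> \<in> ?Q" using stable(2) one_A theta_one by (force intro: rev_image_eqI)
  ultimately show ?case using stable_conj' by (intro exI[of _ ?Q]) auto
next
  case stable_inv
  let ?Q = "{a \<in> topspace (subtopology S A). \<theta> a \<in> P}"
  have "openin (subtopology S A) ?Q"
    using theta_continuous stable_inv(1) by (rule openin_continuous_map_preimage)
  then have "openin S ?Q" using A_open by (simp add: openin_open_subtopology)
  moreover have "\<one> \<in> ?Q" using stable_inv(2) one_A theta_one by (simp add: topspace_eq)
  ultimately show ?case using stable_conj by (intro exI[of _ ?Q]) auto
next
  case (mult x y)
  obtain Q where Q: "openin S Q" "\<one> \<in> Q"
      "\<And>q. q \<in> Q \<Longrightarrow> \<exists>p\<in>P. x \<otimes>\<^bsub>E\<^esub> incl q \<otimes>\<^bsub>E\<^esub> inv\<^bsub>E\<^esub> x = incl p"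
    using mult.IH(1)[OF mult.prems] by blast
  obtain R where R: "openin S R" "\<one> \<in> R"
      "\<And>q. q \<in> R \<Longrightarrow> \<exists>p\<in>Q. y \<otimes>\<^bsub>E\<^esub> incl q \<otimes>\<^bsub>E\<^esub> inv\<^bsub>E\<^esub> y = incl p"
    using mult.IH(2)[OF Q(1,2)] by blast
  have "\<exists>p\<in>P. x \<otimes>\<^bsub>E\<^esub> y \<otimes>\<^bsub>E\<^esub> incl r \<otimes>\<^bsub>E\<^esub> inv\<^bsub>E\<^esub> (x \<otimes>\<^bsub>E\<^esub> y) = incl p" if r: "r \<in> R" for r
  proof -
    obtain q where q: "q \<in> Q" "y \<otimes>\<^bsub>E\<^esub> incl r \<otimes>\<^bsub>E\<^esub> inv\<^bsub>E\<^esub> y = incl q" using R(3)[OF r] by blast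
    have "r \<in> carrier B" using r openin_carrier[OF R(1)] by auto
    then have "x \<otimes>\<^bsub>E\<^esub> y \<otimes>\<^bsub>E\<^esub> incl r \<otimes>\<^bsub>E\<^esub> inv\<^bsub>E\<^esub> (x \<otimes>\<^bsub>E\<^esub> y) =
        x \<otimes>\<^bsub>E\<^esub> (y \<otimes>\<^bsub>E\<^esub> incl r \<otimes>\<^bsub>E\<^esub> inv\<^bsub>E\<^esub> y) \<otimes>\<^bsub>E\<^esub> inv\<^bsub>E\<^esub> x"
      using mult.hyps by (simp add: E.m_assoc E.inv_mult_group)
    then show ?thesis using Q(3)[OF q(1)] by (simp add: q(2))
  qed
  then show ?case using R(1,2) by blast
qed

sublocale incl_top: top_group_hom B S E incl
  by unfold_locales

lemma hnn_topology:
  "topological_group E \<T>" "continuous_map S \<T> incl" "open_map S \<T> incl"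
  using theI'[OF incl_top.ex1_group_topology[OF conj_nbhd_one], folded hnn_topology_def] by auto

sublocale E: top_group E \<T>
  using hnn_topology(1) by unfold_locales

text \<open>An endomorphism of the base group that commutes with \<open>\<theta>\<close> preserves the defining relations, so it
  extends to the HNN-extension by fixing the stable letter. The extension is continuous because it
  is so on the open base group, and it is determined by its values on the generators; so the
  description that defines \<open>hnn_endo\<close> denotes it.\<close>

lemma hnn_endo:
  assumes psi: "\<psi> \<in> hom B B" "continuous_map S S \<psi>"
    and comm: "\<And>a. a \<in> A \<Longrightarrow> \<psi> a \<in> A \<and> \<theta> (\<psi> a) = \<psi> (\<theta> a)"
  defines "\<beta> \<equiv> hnn_endo B S A \<theta> \<psi>"
  shows "\<beta> \<in> hom E E" "continuous_map \<T> \<T> \<beta>" "\<beta> st = st"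
    and "\<And>b. b \<in> carrier B \<Longrightarrow> \<beta> (incl b) = incl (\<psi> b)"
proof -
  interpret \<psi>: group_hom B B \<psi> using psi(1) by unfold_locales
  let ?P = "\<lambda>\<beta>. \<beta> \<in> top_End E \<T> \<and> \<beta> \<in> extensional (carrier E) \<and> \<beta> st = st \<and>
        (\<forall>b\<in>carrier B. \<beta> (incl b) = incl (\<psi> b))"
  have "\<exists>!\<beta>. ?P \<beta>"
  proof (rule ex_ex1I)
    have "(\<lambda>b. incl (\<psi> b)) \<in> hom B E" by (rule homI) simp_all
    moreover have "inv\<^bsub>E\<^esub> st \<otimes>\<^bsub>E\<^esub> incl (\<psi> a) \<otimes>\<^bsub>E\<^esub> st = incl (\<psi> (\<theta> a))" if "a \<in> A" for a
      using comm[OF that] stable_conj[of "\<psi> a"] by simp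
    ultimately obtain F where F: "F \<in> hom E E" "F st = st"
      "\<And>b. b \<in> carrier B \<Longrightarrow> F (incl b) = incl (\<psi> b)"
      using hnn_lift[OF E.is_group, of "\<lambda>b. incl (\<psi> b)" st] stable_closed by metis
    have "continuous_map S \<T> (\<lambda>b. incl (\<psi> b))"
      using continuous_map_compose[OF psi(2) hnn_topology(2)] by (simp add: o_def)
    then have "continuous_map S \<T> (\<lambda>b. F (incl b))"
      by (rule continuous_map_eq) (simp add: F(3) topspace_eq)
    then have "continuous_map \<T> \<T> F"
      by (rule incl_top.continuous_hom_if_continuous_comp[OF hnn_topology hnn_topology(1) F(1)])
    then have "continuous_map \<T> \<T> (restrict F (carrier E))"
      by (rule continuous_map_eq) (simp add: E.topspace_eq)
    moreover have "restrict F (carrier E) \<in> hom E E"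
      using F(1) by (auto simp: hom_def)
    ultimately have "?P (restrict F (carrier E))"
      using F(2,3) by (auto simp: top_End_def)
    then show "\<exists>\<beta>. ?P \<beta>" by blast
  next
    fix \<beta> \<beta>' assume P: "?P \<beta>" "?P \<beta>'"
    have hom: "\<beta> \<in> hom E E" "\<beta>' \<in> hom E E" using P unfolding top_End_def by blast+
    have "\<beta> (incl b) = \<beta>' (incl b)" if "b \<in> carrier B" for b
      using P that by metis
    moreover have "\<beta> st = \<beta>' st" using P by metis
    ultimately have "\<beta> x = \<beta>' x" if "x \<in> carrier E" for x
      using hnn_hom_unique[OF E.is_group hom _ _ that] by blast
    moreover have "\<beta> \<in> extensional (carrier E)" "\<beta>' \<in> extensional (carrier E)"
      using P by blast+
    ultimately show "\<beta> = \<beta>'" by (metis extensionalityI)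
  qed
  then have "?P \<beta>" unfolding \<beta>_def hnn_endo_def by (rule theI')
  then show "\<beta> \<in> hom E E" "continuous_map \<T> \<T> \<beta>" "\<beta> st = st"
    "\<And>b. b \<in> carrier B \<Longrightarrow> \<beta> (incl b) = incl (\<psi> b)"
    by (auto simp: top_End_def)
qed

end

section \<open>Growth of coset covers and the scale\<close>

lemma (in group) card_le_if_separated:
  assumes "subgroup U G" "finite F" "F \<subseteq> carrier G"
    and cover: "\<And>y. y \<in> Y \<Longrightarrow> f y \<in> U <#> F"
    and sep: "\<And>y y'. \<lbrakk>y \<in> Y; y' \<in> Y; f y \<otimes> inv f y' \<in> U\<rbrakk> \<Longrightarrow> y = y'"
  shows "card Y \<le> card F"
proof -
  interpret U: subgroup U G by fact
  have "\<exists>d. d \<in> F \<and> (\<exists>u\<in>U. f y = u \<otimes> d)" if "y \<in> Y" for y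
    using cover[OF that] by (auto simp: set_mult_def)
  then obtain e where e: "\<And>y. y \<in> Y \<Longrightarrow> e y \<in> F" "\<And>y. y \<in> Y \<Longrightarrow> \<exists>u\<in>U. f y = u \<otimes> e y"
    by metis
  have "inj_on e Y"
  proof (rule inj_onI)
    fix y y' assume y: "y \<in> Y" "y' \<in> Y" "e y = e y'"
    obtain u u' where u: "u \<in> U" "u' \<in> U" "f y = u \<otimes> e y" "f y' = u' \<otimes> e y"
      using e(2)[OF y(1)] e(2)[OF y(2)] y(3) by auto
    have "e y \<in> carrier G" using e(1)[OF y(1)] assms(3) by auto
    then have "f y \<otimes> inv f y' = u \<otimes> inv u'"
      using u by (simp add: inv_mult_group m_assoc mult_inv_cancel)
    then show "y = y'" using sep[OF y(1,2)] u by simp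
  qed
  then show ?thesis using e(1) assms(2) by (intro card_inj_on_le[of e]) auto
qed

text \<open>\<open>\<alpha>(W'F') = \<alpha>(W') \<alpha>(F')\<close>: the number of cosets needed is at most multiplied when a cover of
  \<open>X\<close> by cosets of \<open>W'\<close> is pushed forward along \<open>\<alpha>\<close>.\<close>

lemma (in group) cover_mult:
  assumes "subgroup W G" "F \<subseteq> carrier G" "F' \<subseteq> carrier G" "X \<subseteq> carrier G"
    and "\<alpha> \<in> hom G G" "X \<subseteq> W' <#> F'" "\<alpha> ` W' \<subseteq> W <#> F" "W' \<subseteq> carrier G"
  shows "\<alpha> ` X \<subseteq> W <#> (F <#> \<alpha> ` F')"
proof
  interpret \<alpha>: group_hom G G \<alpha> using assms(5) by unfold_locales
  interpret W: subgroup W G by fact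
  fix y assume "y \<in> \<alpha> ` X"
  then obtain w d where wd: "w \<in> W'" "d \<in> F'" "y = \<alpha> (w \<otimes> d)"
    using assms(6) by (auto simp: set_mult_def)
  obtain v c where vc: "v \<in> W" "c \<in> F" "\<alpha> w = v \<otimes> c" using wd(1) assms(7) by (auto simp: set_mult_def)
  have "w \<in> carrier G" "d \<in> carrier G" "c \<in> carrier G" using wd vc assms by auto
  then have "y = v \<otimes> (c \<otimes> \<alpha> d)" using wd(3) vc by (simp add: m_assoc)
  then show "y \<in> W <#> (F <#> \<alpha> ` F')" using vc wd unfolding set_mult_def by blast
qed

lemma (in group) card_set_mult_le:
  assumes "finite X" "finite Y"
  shows "finite (X <#> Y)" "card (X <#> Y) \<le> card X * card Y"
proof -
  have eq: "X <#> Y = (\<lambda>(x, y). x \<otimes> y) ` (X \<times> Y)" by (auto simp: set_mult_def)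
  show "finite (X <#> Y)" using assms by (simp add: eq)
  show "card (X <#> Y) \<le> card X * card Y"
    using card_image_le[of "X \<times> Y" "\<lambda>(x, y). x \<otimes> y"] assms by (simp add: eq card_cartesian_product)
qed

lemma (in group) iterate_cover:
  assumes "subgroup W G" "\<alpha> \<in> hom G G" "finite F" "F \<subseteq> carrier G" "\<alpha> ` W \<subseteq> W <#> F"
  shows "\<exists>F'. finite F' \<and> F' \<subseteq> carrier G \<and> card F' \<le> card F ^ n \<and> (\<alpha> ^^ n) ` W \<subseteq> W <#> F'"
proof (induction n)
  interpret W: subgroup W G by fact
  case 0
  have "W \<subseteq> W <#> {\<one>}" by (force simp: set_mult_def)
  then show ?case by (intro exI[of _ "{\<one>}"]) auto
next
  interpret W: subgroup W G by fact
  interpret \<alpha>: group_hom G G \<alpha> using assms(2) by unfold_locales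
  case (Suc n)
  then obtain F' where F': "finite F'" "F' \<subseteq> carrier G" "card F' \<le> card F ^ n"
    "(\<alpha> ^^ n) ` W \<subseteq> W <#> F'" by blast
  have "(\<alpha> ^^ n) ` W \<subseteq> carrier G"
    by (intro image_subsetI hom_in_carrier[OF hom_funpow[OF assms(2)]] W.mem_carrier)
  then have "\<alpha> ` (\<alpha> ^^ n) ` W \<subseteq> W <#> (F <#> \<alpha> ` F')"
    using assms F' W.subset by (intro cover_mult[where W' = W]) auto
  moreover have "card (F <#> \<alpha> ` F') \<le> card F ^ Suc n"
  proof -
    have "card (F <#> \<alpha> ` F') \<le> card F * card (\<alpha> ` F')"
      using assms(3) F'(1) by (intro card_set_mult_le) auto
    also have "\<dots> \<le> card F * card F ^ n"
      using card_image_le[OF F'(1), of \<alpha>] F'(3) by (intro mult_left_mono) auto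
    finally show ?thesis by simp
  qed
  moreover have "finite (F <#> \<alpha> ` F')" using assms(3) F'(1) by (intro card_set_mult_le) auto
  moreover have "F <#> \<alpha> ` F' \<subseteq> carrier G" using assms(4) F'(2) by (intro set_mult_closed) auto
  ultimately show ?case by (intro exI[of _ "F <#> \<alpha> ` F'"]) (auto simp: image_comp)
qed

lemma nat_le_if_powers_le:
  fixes s m C :: nat
  assumes "\<And>n. s ^ n \<le> C * m ^ n"
  shows "s \<le> m"
proof (rule ccontr)
  assume "\<not> s \<le> m"
  then have ms: "m < s" by simp
  show False
  proof (cases "m = 0")
    case True
    then show False using assms[of 1] ms by simp
  next
    case False
    then have "1 < real s / real m" using ms by simp
    then obtain n where "real C < (real s / real m) ^ n" using real_arch_pow by blast
    then have "real C * real m ^ n < real s ^ n"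
      using False by (simp add: power_divide field_simps)
    then have "C * m ^ n < s ^ n" by (metis of_nat_less_iff of_nat_mult of_nat_power)
    then show False using assms[of n] by simp
  qed
qed

text \<open>The elements of \<open>Y\<close> represent distinct right cosets of \<open>\<phi>\<^sup>n(G)\<close> in \<open>G\<close>. In the chain
  \<open>\<phi>\<^sup>n\<^sup>+\<^sup>1(G) \<le> \<phi>(G) \<le> G\<close> the lower step is isomorphic to \<open>\<phi>\<^sup>n(G) \<le> G\<close>; accordingly the
  representatives for \<open>n + 1\<close> are the products \<open>\<phi>(y) r\<close> with \<open>y\<close> from the previous stage and \<open>r\<close> from a
  transversal of \<open>\<phi>(G)\<close>.\<close>

lemma (in group) powers_of_index:
  assumes "\<phi> \<in> hom G G" "inj_on \<phi> (carrier G)"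
  shows "\<exists>Y\<subseteq>carrier G. card Y = card (rcosets (\<phi> ` carrier G)) ^ n \<and>
    (\<forall>y\<in>Y. \<forall>y'\<in>Y. y \<otimes> inv y' \<in> (\<phi> ^^ n) ` carrier G \<longrightarrow> y = y')"
proof (induction n)
  case 0
  then show ?case by (intro exI[of _ "{\<one>}"]) auto
next
  interpret \<phi>: group_hom G G \<phi> using assms(1) by unfold_locales
  case (Suc n)
  then obtain Y where Y: "Y \<subseteq> carrier G" "card Y = card (rcosets (\<phi> ` carrier G)) ^ n"
    "\<And>y y'. \<lbrakk>y \<in> Y; y' \<in> Y; y \<otimes> inv y' \<in> (\<phi> ^^ n) ` carrier G\<rbrakk> \<Longrightarrow> y = y'" by blast
  obtain R where R: "R \<subseteq> carrier G" "card R = card (rcosets (\<phi> ` carrier G))"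
    "\<And>r r'. \<lbrakk>r \<in> R; r' \<in> R; r \<otimes> inv r' \<in> \<phi> ` carrier G\<rbrakk> \<Longrightarrow> r = r'"
    using transversal_exists[OF \<phi>.img_is_subgroup] by metis
  let ?f = "\<lambda>(y, r). \<phi> y \<otimes> r"
  have sep: "y = y' \<and> r = r'"
    if yr: "y \<in> Y" "r \<in> R" "y' \<in> Y" "r' \<in> R"
      and z: "\<phi> y \<otimes> r \<otimes> inv (\<phi> y' \<otimes> r') = \<phi> ((\<phi> ^^ n) z)" "z \<in> carrier G" for y r y' r' z
  proof -
    have c: "y \<in> carrier G" "y' \<in> carrier G" "r \<in> carrier G" "r' \<in> carrier G"
      using yr Y(1) R(1) by auto
    have zc: "(\<phi> ^^ n) z \<in> carrier G" by (rule hom_in_carrier[OF hom_funpow[OF assms(1)] z(2)])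
    have "\<phi> y \<otimes> (r \<otimes> inv r') \<otimes> inv \<phi> y' = \<phi> ((\<phi> ^^ n) z)"
      using z(1) c by (simp add: m_assoc inv_mult_group)
    then have "\<phi> y \<otimes> (r \<otimes> inv r') = \<phi> ((\<phi> ^^ n) z) \<otimes> \<phi> y'"
      using c zc by (simp add: inv_solve_right' del: \<phi>.hom_mult)
    then have "r \<otimes> inv r' = inv \<phi> y \<otimes> (\<phi> ((\<phi> ^^ n) z) \<otimes> \<phi> y')"
      using c zc by (simp add: inv_solve_left)
    then have "r \<otimes> inv r' = \<phi> (inv y \<otimes> ((\<phi> ^^ n) z \<otimes> y'))" using c zc by simp
    moreover have "inv y \<otimes> ((\<phi> ^^ n) z \<otimes> y') \<in> carrier G" using c zc by simp
    ultimately have r: "r = r'" using R(3)[OF yr(2,4)] by blast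
    then have eq: "\<phi> (y \<otimes> inv y') = \<phi> ((\<phi> ^^ n) z)"
      using z(1) c by (simp add: m_assoc inv_mult_group mult_inv_cancel)
    have "y \<otimes> inv y' = (\<phi> ^^ n) z" using inj_onD[OF assms(2) eq] c zc by simp
    then have "y = y'" using Y(3)[OF yr(1,3)] z(2) by blast
    with r show ?thesis by simp
  qed
  have "inj_on ?f (Y \<times> R)"
  proof (rule inj_onI, clarify)
    fix y r y' r' assume yr: "y \<in> Y" "r \<in> R" "y' \<in> Y" "r' \<in> R" and eq: "\<phi> y \<otimes> r = \<phi> y' \<otimes> r'"
    have one: "(\<phi> ^^ n) \<one> = \<one>" by (induction n) auto
    have "y' \<in> carrier G" "r' \<in> carrier G" using yr Y(1) R(1) by auto
    then have "\<phi> y' \<otimes> r' \<in> carrier G" by simp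
    then show "y = y' \<and> r = r'" using sep[OF yr, of \<one>] eq one by simp
  qed
  then have "card (?f ` (Y \<times> R)) = card (rcosets (\<phi> ` carrier G)) ^ Suc n"
    by (simp add: card_image card_cartesian_product Y(2) R(2))
  moreover have "?f ` (Y \<times> R) \<subseteq> carrier G" using Y(1) R(1) by (auto simp: subset_eq)
  moreover have "x = x'" if x: "x \<in> ?f ` (Y \<times> R)" "x' \<in> ?f ` (Y \<times> R)"
      "x \<otimes> inv x' \<in> (\<phi> ^^ Suc n) ` carrier G" for x x'
  proof -
    obtain y r y' r' where yr: "y \<in> Y" "r \<in> R" "y' \<in> Y" "r' \<in> R" "x = \<phi> y \<otimes> r" "x' = \<phi> y' \<otimes> r'"
      using x(1,2) by auto
    obtain z where "z \<in> carrier G" "\<phi> y \<otimes> r \<otimes> inv (\<phi> y' \<otimes> r') = \<phi> ((\<phi> ^^ n) z)"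
      using x(3) yr by auto
    then show "x = x'" using sep[OF yr(1-4)] yr(5,6) by simp
  qed
  ultimately show ?case by (intro exI[of _ "?f ` (Y \<times> R)"] conjI ballI impI)
qed

text \<open>Two elements of \<open>V\<close> lie in the same coset of \<open>W \<inter> V\<close> iff they lie in the same coset of \<open>W\<close>. The
  index thus counts the cosets of \<open>W\<close> that meet \<open>V\<close>, a number that behaves well under iteration.\<close>

lemma (in group) subgroup_index_Int:
  assumes "subgroup W G" "subgroup V G"
  shows "subgroup_index (G\<lparr>carrier := V\<rparr>) (W \<inter> V) = card ((\<lambda>x. W #> x) ` V)"
proof -
  interpret W: subgroup W G by fact
  interpret V: subgroup V G by fact
  have WV: "subgroup (W \<inter> V) G" using assms by (simp add: subgroups_Inter_pair)
  have "rcosets\<^bsub>G\<lparr>carrier := V\<rparr>\<^esub> (W \<inter> V) = (\<lambda>x. (W \<inter> V) #> x) ` V"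
    by (auto simp: RCOSETS_def)
  moreover have "card ((\<lambda>x. (W \<inter> V) #> x) ` V) = card ((\<lambda>x. W #> x) ` V)"
  proof (rule card_image_eq_if_same_fibres)
    show "(W \<inter> V) #> x = (W \<inter> V) #> y \<longleftrightarrow> W #> x = W #> y" if "x \<in> V" "y \<in> V" for x y
      using that rcos_eq_iff[OF WV] rcos_eq_iff[OF assms(1)] by auto
  qed
  ultimately show ?thesis by (simp add: subgroup_index_def)
qed

context top_group
begin

lemma compact_finite_cover:
  assumes "compactin T K" "subgroup W G" "openin T W"
  obtains F where "finite F" "F \<subseteq> carrier G" "K \<subseteq> W <#> F"
proof -
  have K: "K \<subseteq> carrier G" using assms(1) compactin_subset_topspace topspace_eq by metis
  have "\<forall>C\<in>(\<lambda>x. W #> x) ` K. openin T C" using K assms(3) openin_r_coset by auto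
  moreover have "K \<subseteq> \<Union>((\<lambda>x. W #> x) ` K)" using K rcos_self[OF _ assms(2)] by blast
  ultimately obtain \<F> where \<F>: "finite \<F>" "\<F> \<subseteq> (\<lambda>x. W #> x) ` K" "K \<subseteq> \<Union>\<F>"
    using assms(1) unfolding compactin_def by meson
  obtain F where F: "F \<subseteq> K" "finite F" "\<F> = (\<lambda>x. W #> x) ` F"
    using finite_subset_image[OF \<F>(1,2)] by auto
  have "K \<subseteq> W <#> F" using \<F>(3) F(3) by (fastforce simp: set_mult_def r_coset_def)
  then show thesis using that F K by blast
qed

text \<open>Compactness makes the index finite; an infinite one would have been given the value \<open>0\<close>,
  and the bound on \<open>card F\<close> would fail.\<close>

lemma minimal_finite_cover:
  assumes "compactin T V" "subgroup V G" "subgroup W G" "openin T W"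
  obtains F where "finite F" "F \<subseteq> carrier G" "V \<subseteq> W <#> F"
    "card F \<le> subgroup_index (G\<lparr>carrier := V\<rparr>) (W \<inter> V)"
proof -
  interpret V: subgroup V G by fact
  obtain D where D: "finite D" "D \<subseteq> carrier G" "V \<subseteq> W <#> D"
    using compact_finite_cover[OF assms(1,3,4)] by blast
  let ?C = "(\<lambda>x. W #> x) ` V"
  have "?C \<subseteq> (\<lambda>x. W #> x) ` D"
  proof
    fix C assume "C \<in> ?C"
    then obtain x where x: "x \<in> V" "C = W #> x" by blast
    then obtain w d where "w \<in> W" "d \<in> D" "x = w \<otimes> d" using D(3) by (auto simp: set_mult_def)
    then have "d \<in> D" "x \<in> W #> d" by (auto simp: r_coset_def)
    then show "C \<in> (\<lambda>x. W #> x) ` D" using x(2) D(2) repr_independence[OF _ _ assms(3)] by blast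
  qed
  then have fin: "finite ?C" using D(1) finite_surj by blast
  obtain F where F: "F \<subseteq> V" "?C = (\<lambda>x. W #> x) ` F" "inj_on (\<lambda>x. W #> x) F"
    using subset_image_inj[of ?C "\<lambda>x. W #> x" V] by auto
  have "finite F" using F(2,3) fin by (simp add: finite_image_iff)
  moreover have "V \<subseteq> W <#> F"
  proof
    fix x assume x: "x \<in> V"
    then obtain d where d: "d \<in> F" "W #> x = W #> d" using F(2) by blast
    then have "x \<in> W #> d" using rcos_self[OF V.mem_carrier[OF x] assms(3)] by simp
    then show "x \<in> W <#> F" using d(1) by (auto simp: set_mult_def r_coset_def)
  qed
  moreover have "card F = subgroup_index (G\<lparr>carrier := V\<rparr>) (W \<inter> V)"
    using card_image[OF F(3)] by (simp add: subgroup_index_Int[OF assms(3,2)] F(2))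
  ultimately show thesis using that F(1) V.subset by auto
qed

text \<open>With \<open>m\<close> the index on the right, \<open>\<alpha>\<^sup>n(W)\<close> is covered by \<open>m\<^sup>n\<close> cosets of \<open>W\<close>. If \<open>U \<subseteq> WD\<close> and
  \<open>W \<subseteq> UD'\<close> with \<open>D\<close> and \<open>D'\<close> finite, then \<open>\<alpha>\<^sup>n(U)\<close> is covered by \<open>|D'| m\<^sup>n |D|\<close> cosets of \<open>U\<close>,
  while it meets at least \<open>s\<^sup>n\<close> of them. Hence \<open>s\<^sup>n \<le> |D'||D| m\<^sup>n\<close> for all \<open>n\<close>.\<close>

lemma index_ge_if_growth:
  assumes U: "compact_open_subgroup G T U" and W: "compact_open_subgroup G T W"
    and \<alpha>: "\<alpha> \<in> hom G G" "continuous_map T T \<alpha>"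
    and growth: "\<And>n. \<exists>Y f. card (Y :: 'y set) = s ^ n \<and> f ` Y \<subseteq> U \<and>
      (\<forall>y\<in>Y. \<forall>y'\<in>Y. (\<alpha> ^^ n) (f y) \<otimes> inv (\<alpha> ^^ n) (f y') \<in> U \<longrightarrow> y = y')"
  shows "s \<le> subgroup_index (G\<lparr>carrier := \<alpha> ` W\<rparr>) (W \<inter> \<alpha> ` W)"
proof -
  interpret \<alpha>: group_hom G G \<alpha> using \<alpha>(1) by unfold_locales
  have Us: "subgroup U G" "compactin T U" "openin T U"
    and Ws: "subgroup W G" "compactin T W" "openin T W"
    using U W by (auto simp: compact_open_subgroup_def)
  have UG: "U \<subseteq> carrier G" and WG: "W \<subseteq> carrier G" using Us Ws by (auto dest: subgroup.subset)
  note hom_pow = hom_funpow[OF \<alpha>(1)]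
  let ?m = "subgroup_index (G\<lparr>carrier := \<alpha> ` W\<rparr>) (W \<inter> \<alpha> ` W)"
  obtain F where F: "finite F" "F \<subseteq> carrier G" "\<alpha> ` W \<subseteq> W <#> F" "card F \<le> ?m"
    using minimal_finite_cover[OF image_compactin[OF Ws(2) \<alpha>(2)]
        \<alpha>.subgroup_img_is_subgroup[OF Ws(1)] Ws(1,3)] by blast
  obtain D where D: "finite D" "D \<subseteq> carrier G" "U \<subseteq> W <#> D"
    using compact_finite_cover[OF Us(2) Ws(1,3)] by blast
  obtain D' where D': "finite D'" "D' \<subseteq> carrier G" "W \<subseteq> U <#> D'"
    using compact_finite_cover[OF Ws(2) Us(1,3)] by blast
  have "s ^ n \<le> card D' * card D * ?m ^ n" for n
  proof -
    obtain F' where F': "finite F'" "F' \<subseteq> carrier G" "card F' \<le> card F ^ n"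
      "(\<alpha> ^^ n) ` W \<subseteq> W <#> F'"
      using iterate_cover[OF Ws(1) \<alpha>(1) F(1-3), of n] by blast
    let ?D = "(\<alpha> ^^ n) ` D"
    have DG: "?D \<subseteq> carrier G" by (intro image_subsetI hom_in_carrier[OF hom_pow] subsetD[OF D(2)])
    have "(\<alpha> ^^ n) ` W \<subseteq> U <#> (D' <#> F')"
    proof -
      have "W <#> F' \<subseteq> U <#> D' <#> F'" using D'(3) by (rule mono_set_mult) simp
      then show ?thesis using F'(4) set_mult_assoc[OF UG D'(2) F'(2)] by simp
    qed
    then have cover: "(\<alpha> ^^ n) ` U \<subseteq> U <#> (D' <#> F' <#> ?D)"
      using cover_mult[OF Us(1) set_mult_closed[OF D'(2) F'(2)] D(2) UG hom_pow D(3) _ WG] by simp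
    obtain Y :: "'y set" and f where Yf: "card Y = s ^ n \<and> f ` Y \<subseteq> U \<and>
        (\<forall>y\<in>Y. \<forall>y'\<in>Y. (\<alpha> ^^ n) (f y) \<otimes> inv (\<alpha> ^^ n) (f y') \<in> U \<longrightarrow> y = y')"
      using growth[of n] by (elim exE) (rule that)
    have Y: "card Y = s ^ n" using Yf by (rule conjunct1)
    have "s ^ n \<le> card (D' <#> F' <#> ?D)"
      unfolding Y[symmetric]
    proof (rule card_le_if_separated[OF Us(1), where f = "\<lambda>y. (\<alpha> ^^ n) (f y)"])
      show "finite (D' <#> F' <#> ?D)" using D'(1) F'(1) D(1) by (simp add: card_set_mult_le(1))
      show "D' <#> F' <#> ?D \<subseteq> carrier G" using D'(2) F'(2) DG by (simp add: set_mult_closed)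
      show "(\<alpha> ^^ n) (f y) \<in> U <#> (D' <#> F' <#> ?D)" if "y \<in> Y" for y
        using Yf that by (intro subsetD[OF cover]) auto
    qed (use Yf in simp)
    also have "\<dots> \<le> card (D' <#> F') * card ?D"
      using D'(1) F'(1) D(1) by (simp add: card_set_mult_le)
    also have "\<dots> \<le> (card D' * card F') * card D"
      using card_set_mult_le(2)[OF D'(1) F'(1)] card_image_le[OF D(1)] by (rule mult_le_mono)
    also have "\<dots> \<le> card D' * ?m ^ n * card D"
      using F'(3) power_mono[OF F(4), of n] by (intro mult_le_mono) auto
    finally show ?thesis by (simp add: ac_simps)
  qed
  then show ?thesis by (rule nat_le_if_powers_le)
qed

end

section \<open>The endomorphism and its scale\<close>

text \<open>The setting of the theorem. In it, \<open>hnn.E\<close>, \<open>hnn.\<T>\<close>,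
  \<open>hnn.st\<close> and \<open>hnn.incl\<close> are the extension, its topology, the stable letter and the inclusion of
  \<open>G1 \<times>\<times> G2\<close>.\<close>

locale product_hnn =
  fixes G1 :: "('a, 'm) monoid_scheme" and T1 :: "'a topology"
    and G2 :: "('b, 'n) monoid_scheme" and T2 :: "'b topology"
    and H1 :: "'a set" and \<phi>1 :: "'a \<Rightarrow> 'a"
    and H2 :: "'b set" and \<phi>2 :: "'b \<Rightarrow> 'b"
  assumes tdc: "totally_disconnected_compact_group G1 T1" "totally_disconnected_compact_group G2 T2"
    and cos: "compact_open_subgroup G1 T1 H1" "compact_open_subgroup G2 T2 H2"
    and iso: "topological_iso_onto G1 T1 G1 T1 H1 \<phi>1" "topological_iso_onto G2 T2 G2 T2 H2 \<phi>2"
begin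

sublocale G1: top_group G1 T1
  using tdc(1) by (simp add: totally_disconnected_compact_group_def top_group_def
      top_group_axioms_def topological_group_def)

sublocale G2: top_group G2 T2
  using tdc(2) by (simp add: totally_disconnected_compact_group_def top_group_def
      top_group_axioms_def topological_group_def)

lemmas phi1 = topological_iso_ontoD[OF G1.topspace_eq cos(1) iso(1)]
lemmas phi2 = topological_iso_ontoD[OF G2.topspace_eq cos(2) iso(2)]

sublocale \<phi>1: group_hom G1 G1 \<phi>1 using phi1(1) by unfold_locales
sublocale \<phi>2: group_hom G2 G2 \<phi>2 using phi2(1) by unfold_locales

abbreviation \<psi>1 where "\<psi>1 \<equiv> inv_into (carrier G1) \<phi>1"

lemma psi1_phi1 [simp]: "g \<in> carrier G1 \<Longrightarrow> \<psi>1 (\<phi>1 g) = g"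
  using phi1(2) by (rule inv_into_f_f)

lemma phi1_H1 [simp]: "g \<in> carrier G1 \<Longrightarrow> \<phi>1 g \<in> H1"
  using phi1(3) by blast

lemma H1_iff: "h \<in> H1 \<longleftrightarrow> (\<exists>g\<in>carrier G1. h = \<phi>1 g)"
  using phi1(3) by blast

sublocale B: top_group "G1 \<times>\<times> G2" "prod_topology T1 T2"
  using topological_group_DirProd[OF G1.topological_group G2.topological_group]
  by (simp add: top_group_def top_group_axioms_def topological_group_def)

sublocale hnn: top_hnn_data "G1 \<times>\<times> G2" "prod_topology T1 T2" "H1 \<times> carrier G2"
  "\<lambda>(h1, g2). (\<psi>1 h1, \<phi>2 g2)"
proof (intro top_hnn_data.intro hnn_data.intro hnn_data_axioms.intro top_hnn_data_axioms.intro)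
  let ?S = "prod_topology T1 T2" and ?A = "H1 \<times> carrier G2"
  let ?\<theta> = "\<lambda>(h1, g2). (\<psi>1 h1, \<phi>2 g2)"
  have H: "subgroup H1 G1" "openin T1 H1" "subgroup H2 G2" "openin T2 H2"
    using cos by (auto simp: compact_open_subgroup_def)
  show "group (G1 \<times>\<times> G2)" "top_group (G1 \<times>\<times> G2) ?S"
    by (rule B.is_group B.top_group_axioms)+
  show "subgroup ?A (G1 \<times>\<times> G2)"
    using DirProd_subgroups[OF G1.is_group H(1) G2.is_group G2.subgroup_self] by simp
  show "?\<theta> \<in> hom ((G1 \<times>\<times> G2)\<lparr>carrier := ?A\<rparr>) (G1 \<times>\<times> G2)"
  proof (rule homI)
    fix x y assume xy: "x \<in> carrier ((G1 \<times>\<times> G2)\<lparr>carrier := ?A\<rparr>)" "y \<in> carrier ((G1 \<times>\<times> G2)\<lparr>carrier := ?A\<rparr>)"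
    then obtain g g2 h h2 where "x = (\<phi>1 g, g2)" "y = (\<phi>1 h, h2)" "g \<in> carrier G1" "h \<in> carrier G1"
      "g2 \<in> carrier G2" "h2 \<in> carrier G2" by (auto simp: H1_iff)
    then show "?\<theta> (x \<otimes>\<^bsub>(G1 \<times>\<times> G2)\<lparr>carrier := ?A\<rparr>\<^esub> y) = ?\<theta> x \<otimes>\<^bsub>G1 \<times>\<times> G2\<^esub> ?\<theta> y"
      by (simp flip: \<phi>1.hom_mult)
  qed (auto simp: H1_iff)
  show "openin ?S ?A" using H(2) openin_topspace[of T2] by (simp add: openin_prod_Times_iff G2.topspace_eq)
  have sub: "subtopology ?S ?A = prod_topology (subtopology T1 H1) T2"
    by (simp add: subtopology_Times flip: G2.topspace_eq)
  have "homeomorphic_map (subtopology ?S ?A) (prod_topology T1 (subtopology T2 H2)) ?\<theta>"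
    unfolding sub using phi1(6) phi2(4) by (rule homeomorphic_map_prod)
  moreover have sub': "prod_topology T1 (subtopology T2 H2) = subtopology ?S (carrier G1 \<times> H2)"
    by (simp add: subtopology_Times flip: G1.topspace_eq)
  ultimately have \<theta>: "continuous_map (subtopology ?S ?A) (subtopology ?S (carrier G1 \<times> H2)) ?\<theta>"
    "open_map (subtopology ?S ?A) (subtopology ?S (carrier G1 \<times> H2)) ?\<theta>"
    by (simp_all add: homeomorphic_imp_continuous_map homeomorphic_imp_open_map)
  show "continuous_map (subtopology ?S ?A) ?S ?\<theta>"
    using \<theta>(1) by (simp add: continuous_map_in_subtopology)
  have "openin ?S (carrier G1 \<times> H2)"
    using H(4) openin_topspace[of T1] by (simp add: openin_prod_Times_iff G1.topspace_eq)
  then show "open_map (subtopology ?S ?A) ?S ?\<theta>"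
    using \<theta>(2) by (simp add: open_map_def openin_open_subtopology)
qed

abbreviation U where "U \<equiv> hnn.incl ` (carrier G1 \<times> carrier G2)"

definition beta where
  "beta = hnn_endo (G1 \<times>\<times> G2) (prod_topology T1 T2) (H1 \<times> carrier G2)
    (\<lambda>(h1, g2). (\<psi>1 h1, \<phi>2 g2)) (\<lambda>(g1, g2). (\<phi>1 g1, g2))"

definition alpha where "alpha = conj_by hnn.E hnn.st \<circ> beta"

lemma beta:
  "beta \<in> hom hnn.E hnn.E" "continuous_map hnn.\<T> hnn.\<T> beta" "beta hnn.st = hnn.st"
  "\<And>g1 g2. \<lbrakk>g1 \<in> carrier G1; g2 \<in> carrier G2\<rbrakk> \<Longrightarrow> beta (hnn.incl (g1, g2)) = hnn.incl (\<phi>1 g1, g2)"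
proof -
  let ?\<psi> = "\<lambda>(g1, g2). (\<phi>1 g1, g2)"
  have hom: "?\<psi> \<in> hom (G1 \<times>\<times> G2) (G1 \<times>\<times> G2)" by (rule homI) auto
  have cont: "continuous_map (prod_topology T1 T2) (prod_topology T1 T2) ?\<psi>"
    using continuous_map_compose[OF continuous_map_fst phi1(5)]
    by (simp add: continuous_map_pairwise o_def case_prod_unfold continuous_map_snd)
  have comm: "?\<psi> a \<in> H1 \<times> carrier G2 \<and>
      (\<lambda>(h1, g2). (\<psi>1 h1, \<phi>2 g2)) (?\<psi> a) = ?\<psi> ((\<lambda>(h1, g2). (\<psi>1 h1, \<phi>2 g2)) a)"
    if a: "a \<in> H1 \<times> carrier G2" for a
  proof -
    obtain g c where "a = (\<phi>1 g, c)" "g \<in> carrier G1" "c \<in> carrier G2"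
      using a phi1(3) by auto
    then show ?thesis by simp
  qed
  note * = hnn.hnn_endo[OF hom cont comm, folded beta_def]
  show "beta \<in> hom hnn.E hnn.E" "continuous_map hnn.\<T> hnn.\<T> beta" "beta hnn.st = hnn.st"
    using * by blast+
  show "beta (hnn.incl (g1, g2)) = hnn.incl (\<phi>1 g1, g2)"
    if "g1 \<in> carrier G1" "g2 \<in> carrier G2" for g1 g2
    using *(4)[of "(g1, g2)"] that by simp
qed

sublocale \<beta>: group_hom hnn.E hnn.E beta using beta(1) by unfold_locales

lemma alpha_eq: "alpha x = hnn.st \<otimes>\<^bsub>hnn.E\<^esub> beta x \<otimes>\<^bsub>hnn.E\<^esub> inv\<^bsub>hnn.E\<^esub> hnn.st"
  by (simp add: alpha_def conj_by_def)

lemma alpha_hom: "alpha \<in> hom hnn.E hnn.E"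
  by (rule homI) (simp_all add: alpha_eq hnn.E.m_assoc hnn.E.mult_inv_cancel)

sublocale \<alpha>: group_hom hnn.E hnn.E alpha using alpha_hom by unfold_locales

lemmas alpha_pow_hom = hnn.E.hom_funpow[OF alpha_hom]

lemma alpha_continuous: "continuous_map hnn.\<T> hnn.\<T> alpha"
  unfolding alpha_eq[abs_def] using beta(2) hnn.E.topspace_eq
  by (intro hnn.E.continuous_map_mult) auto

lemma alpha_pow_continuous: "continuous_map hnn.\<T> hnn.\<T> (alpha ^^ n)"
proof (induction n)
  case (Suc n)
  then show ?case using continuous_map_compose[OF Suc alpha_continuous] by (simp add: o_def)
qed simp

lemma alpha_pow_closed: "x \<in> carrier hnn.E \<Longrightarrow> (alpha ^^ n) x \<in> carrier hnn.E"
  by (rule hom_in_carrier[OF alpha_pow_hom])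

lemma phi1_pow_closed: "g \<in> carrier G1 \<Longrightarrow> (\<phi>1 ^^ n) g \<in> carrier G1"
  by (rule hom_in_carrier[OF G1.hom_funpow[OF phi1(1)]])

lemma phi2_pow_closed: "g \<in> carrier G2 \<Longrightarrow> (\<phi>2 ^^ n) g \<in> carrier G2"
  by (rule hom_in_carrier[OF G2.hom_funpow[OF phi2(1)]])

text \<open>The element \<open>(\<phi>\<^sub>1(g\<^sub>1), \<phi>\<^sub>2(c))\<close> is \<open>\<theta>(\<phi>\<^sub>1(\<phi>\<^sub>1(g\<^sub>1)), c)\<close>, and conjugation by the stable letter undoes
  \<open>\<theta>\<close>.\<close>

lemma alpha_incl:
  assumes "g1 \<in> carrier G1" "c \<in> carrier G2"
  shows "alpha (hnn.incl (g1, \<phi>2 c)) = hnn.incl (\<phi>1 (\<phi>1 g1), c)"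
  using assms hnn.stable_conj'[of "(\<phi>1 (\<phi>1 g1), c)"]
  by (simp add: alpha_eq beta(4))

lemma alpha_pow_incl:
  assumes "g1 \<in> carrier G1" "c \<in> carrier G2"
  shows "(alpha ^^ n) (hnn.incl (g1, (\<phi>2 ^^ n) c)) = hnn.incl ((\<phi>1 ^^ (2 * n)) g1, c)"
  using assms
proof (induction n arbitrary: g1)
  case (Suc n)
  then have "(alpha ^^ Suc n) (hnn.incl (g1, (\<phi>2 ^^ Suc n) c)) =
      (alpha ^^ n) (hnn.incl (\<phi>1 (\<phi>1 g1), (\<phi>2 ^^ n) c))"
    by (simp add: funpow_swap1 phi2_pow_closed flip: alpha_incl)
  also have "\<dots> = hnn.incl ((\<phi>1 ^^ (2 * Suc n)) g1, c)"
    using Suc by (simp add: funpow_swap1)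
  finally show ?case .
qed simp

text \<open>The quotient that forgets \<open>G1\<close>, composed with the permutation representation of \<open>G2\<close>. The letter
  \<open>t\<close> goes to \<open>\<sigma>\<inverse>\<close>, and \<open>\<beta>\<close> induces the identity on the image, as it changes first coordinates
  only; so \<open>\<alpha>\<close> induces conjugation by \<open>\<sigma>\<inverse>\<close>.\<close>

lemma projection:
  obtains K :: "('b \<times> (nat \<Rightarrow> 'b) \<Rightarrow> 'b \<times> (nat \<Rightarrow> 'b)) monoid" and F \<iota> \<sigma>
  where "group K" "F \<in> hom hnn.E K" "\<iota> \<in> hom G2 K" "inj_on \<iota> (carrier G2)" "\<sigma> \<in> carrier K"
    and "\<And>g. g \<in> carrier G2 \<Longrightarrow> \<sigma> \<otimes>\<^bsub>K\<^esub> \<iota> g \<otimes>\<^bsub>K\<^esub> inv\<^bsub>K\<^esub> \<sigma> = \<iota> (\<phi>2 g)"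
    and "\<And>g1 g2. \<lbrakk>g1 \<in> carrier G1; g2 \<in> carrier G2\<rbrakk> \<Longrightarrow> F (hnn.incl (g1, g2)) = \<iota> g2"
    and "\<And>x. x \<in> carrier hnn.E \<Longrightarrow> F (alpha x) = inv\<^bsub>K\<^esub> \<sigma> \<otimes>\<^bsub>K\<^esub> F x \<otimes>\<^bsub>K\<^esub> \<sigma>"
proof -
  obtain K :: "('b \<times> (nat \<Rightarrow> 'b) \<Rightarrow> 'b \<times> (nat \<Rightarrow> 'b)) monoid" and \<iota> \<sigma>
    where K: "group K" "\<iota> \<in> hom G2 K" "inj_on \<iota> (carrier G2)" "\<sigma> \<in> carrier K"
      "\<And>g. g \<in> carrier G2 \<Longrightarrow> \<sigma> \<otimes>\<^bsub>K\<^esub> \<iota> g \<otimes>\<^bsub>K\<^esub> inv\<^bsub>K\<^esub> \<sigma> = \<iota> (\<phi>2 g)"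
    using G2.endomorphism_as_conjugation[OF phi2(1,2)] by metis
  interpret K: group K by fact
  interpret \<iota>: group_hom G2 K \<iota> using K(2) by unfold_locales
  have "\<iota> \<circ> snd \<in> hom (G1 \<times>\<times> G2) K" by (rule homI) auto
  moreover have "inv\<^bsub>K\<^esub> (inv\<^bsub>K\<^esub> \<sigma>) \<otimes>\<^bsub>K\<^esub> (\<iota> \<circ> snd) a \<otimes>\<^bsub>K\<^esub> inv\<^bsub>K\<^esub> \<sigma> =
      (\<iota> \<circ> snd) ((\<lambda>(h1, g2). (\<psi>1 h1, \<phi>2 g2)) a)" if "a \<in> H1 \<times> carrier G2" for a
    using that K(4,5) by auto
  ultimately obtain F where F: "F \<in> hom hnn.E K" "F hnn.st = inv\<^bsub>K\<^esub> \<sigma>"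
    "\<And>b. b \<in> carrier (G1 \<times>\<times> G2) \<Longrightarrow> F (hnn.incl b) = (\<iota> \<circ> snd) b"
    using hnn.hnn_lift[OF K(1), of "\<iota> \<circ> snd" "inv\<^bsub>K\<^esub> \<sigma>"] K.inv_closed[OF K(4)] by metis
  interpret F: group_hom hnn.E K F using F(1) by unfold_locales
  have F_incl: "F (hnn.incl (g1, g2)) = \<iota> g2" if "g1 \<in> carrier G1" "g2 \<in> carrier G2" for g1 g2
    using F(3)[of "(g1, g2)"] that by simp
  have "F (beta x) = F x" if "x \<in> carrier hnn.E" for x
    using that
  proof (induction rule: hnn.hnn_induct)
    case (base b)
    then show ?case by (auto simp: beta(4) F_incl)
  qed (simp_all add: beta(3))
  then have F_alpha: "F (alpha x) = inv\<^bsub>K\<^esub> \<sigma> \<otimes>\<^bsub>K\<^esub> F x \<otimes>\<^bsub>K\<^esub> \<sigma>" if "x \<in> carrier hnn.E" for x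
    using that K(4) by (simp add: alpha_eq F(2))
  show thesis by (rule that[OF K(1) F(1) K(2-5) F_incl F_alpha])
qed

text \<open>In the image under the projection, \<open>\<alpha>\<^sup>n(g\<^sub>1, g\<^sub>2) = (b, c)\<close> reads \<open>\<sigma>\<^sup>-\<^sup>n g\<^sub>2 \<sigma>\<^sup>n = c\<close>, that is
  \<open>g\<^sub>2 = \<phi>\<^sub>2\<^sup>n(c)\<close>; and \<open>G2\<close> is embedded there.\<close>

lemma alpha_pow_incl_in_U_iff:
  assumes g: "g1 \<in> carrier G1" "g2 \<in> carrier G2"
  shows "(alpha ^^ n) (hnn.incl (g1, g2)) \<in> U \<longleftrightarrow> g2 \<in> (\<phi>2 ^^ n) ` carrier G2"
proof
  assume "g2 \<in> (\<phi>2 ^^ n) ` carrier G2"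
  then obtain c where "c \<in> carrier G2" "g2 = (\<phi>2 ^^ n) c" by blast
  then show "(alpha ^^ n) (hnn.incl (g1, g2)) \<in> U"
    using alpha_pow_incl[OF g(1)] phi1_pow_closed[OF g(1)] by simp
next
  assume in_U: "(alpha ^^ n) (hnn.incl (g1, g2)) \<in> U"
  show "g2 \<in> (\<phi>2 ^^ n) ` carrier G2"
  proof (rule projection)
    fix K :: "('b \<times> (nat \<Rightarrow> 'b) \<Rightarrow> 'b \<times> (nat \<Rightarrow> 'b)) monoid" and F \<iota> \<sigma>
    assume K: "group K" "F \<in> hom hnn.E K" "\<iota> \<in> hom G2 K" "inj_on \<iota> (carrier G2)" "\<sigma> \<in> carrier K"
      "\<And>g. g \<in> carrier G2 \<Longrightarrow> \<sigma> \<otimes>\<^bsub>K\<^esub> \<iota> g \<otimes>\<^bsub>K\<^esub> inv\<^bsub>K\<^esub> \<sigma> = \<iota> (\<phi>2 g)"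
      and F_incl: "\<And>g1 g2. \<lbrakk>g1 \<in> carrier G1; g2 \<in> carrier G2\<rbrakk> \<Longrightarrow> F (hnn.incl (g1, g2)) = \<iota> g2"
      and F_alpha: "\<And>x. x \<in> carrier hnn.E \<Longrightarrow> F (alpha x) = inv\<^bsub>K\<^esub> \<sigma> \<otimes>\<^bsub>K\<^esub> F x \<otimes>\<^bsub>K\<^esub> \<sigma>"
    interpret K: group K by fact
    interpret F: group_hom hnn.E K F using K(2) by unfold_locales
    have pow: "F x = \<iota> ((\<phi>2 ^^ n) c)"
      if "x \<in> carrier hnn.E" "c \<in> carrier G2" "F ((alpha ^^ n) x) = \<iota> c" for x c n
      using that
    proof (induction n arbitrary: x)
      case (Suc n)
      then have "F (alpha x) = \<iota> ((\<phi>2 ^^ n) c)" by (simp add: funpow_swap1)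
      then have "inv\<^bsub>K\<^esub> \<sigma> \<otimes>\<^bsub>K\<^esub> F x \<otimes>\<^bsub>K\<^esub> \<sigma> = \<iota> ((\<phi>2 ^^ n) c)" using F_alpha Suc.prems by simp
      then have "\<sigma> \<otimes>\<^bsub>K\<^esub> (inv\<^bsub>K\<^esub> \<sigma> \<otimes>\<^bsub>K\<^esub> F x \<otimes>\<^bsub>K\<^esub> \<sigma>) \<otimes>\<^bsub>K\<^esub> inv\<^bsub>K\<^esub> \<sigma> = \<iota> (\<phi>2 ((\<phi>2 ^^ n) c))"
        using K(6) phi2_pow_closed Suc.prems by simp
      then show ?case using K(5) Suc.prems by (simp add: K.m_assoc K.mult_inv_cancel)
    qed simp
    obtain b1 c where c: "b1 \<in> carrier G1" "c \<in> carrier G2"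
      "(alpha ^^ n) (hnn.incl (g1, g2)) = hnn.incl (b1, c)" using in_U by auto
    then have "\<iota> g2 = \<iota> ((\<phi>2 ^^ n) c)"
      using pow[of "hnn.incl (g1, g2)" c n] F_incl g by simp
    then have "g2 = (\<phi>2 ^^ n) c"
      using inj_onD[OF K(4)] g(2) phi2_pow_closed[OF c(2)] by blast
    then show "g2 \<in> (\<phi>2 ^^ n) ` carrier G2"
      using c(2) by blast
  qed
qed

lemma phi2_pow_image_decreasing:
  assumes "m \<le> n" shows "(\<phi>2 ^^ n) ` carrier G2 \<subseteq> (\<phi>2 ^^ m) ` carrier G2"
proof -
  have "(\<phi>2 ^^ n) g = (\<phi>2 ^^ m) ((\<phi>2 ^^ (n - m)) g)" for g
    using assms funpow_add[of m "n - m" \<phi>2] by simp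
  then show ?thesis using phi2_pow_closed by auto
qed

lemma U_subgroup: "subgroup U hnn.E"
  using hnn.incl.img_is_subgroup by simp

lemma U_open: "openin hnn.\<T> U"
  using hnn.hnn_topology(3) openin_topspace[of "prod_topology T1 T2"]
  by (simp add: open_map_def G1.topspace_eq G2.topspace_eq)

lemma U_compact_open: "compact_open_subgroup hnn.E hnn.\<T> U"
proof -
  have "compact_space (prod_topology T1 T2)"
    using tdc by (simp add: totally_disconnected_compact_group_def compact_space_prod_topology)
  then have "compactin (prod_topology T1 T2) (carrier G1 \<times> carrier G2)"
    by (simp add: compact_space_def G1.topspace_eq G2.topspace_eq)
  then have "compactin hnn.\<T> U" using hnn.hnn_topology(2) by (rule image_compactin)
  then show ?thesis using U_subgroup U_open by (simp add: compact_open_subgroup_def)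
qed

lemma U_minus_iff: "x \<in> U_minus hnn.E alpha U \<longleftrightarrow> x \<in> carrier hnn.E \<and> (\<forall>k. (alpha ^^ k) x \<in> U)"
proof -
  have "x \<in> U_minus hnn.E alpha U \<longleftrightarrow> (\<forall>n. \<forall>k\<le>n. x \<in> carrier hnn.E \<and> (alpha ^^ k) x \<in> U)"
    unfolding U_minus_def U_neg_def pow_vimage_def INT_iff mem_Collect_eq
    by (simp add: Ball_def)
  then show ?thesis by (metis order_refl)
qed

text \<open>\<open>(g, c) = (1, c) (g, 1)\<close>, where the first factor has the backward orbit \<open>(1, \<phi>\<^sub>2\<^sup>n(c))\<close> in \<open>U\<close>
  and the second one the forward orbit \<open>(\<phi>\<^sub>1\<^sup>2\<^sup>n(g), 1)\<close>.\<close>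

lemma U_tidy_above: "tidy_above hnn.E alpha U"
  unfolding tidy_above_def
proof
  have plus: "hnn.incl (\<one>\<^bsub>G1\<^esub>, c) \<in> U_pos alpha U n" if "c \<in> carrier G2" for c n
    using that
  proof (induction n arbitrary: c)
    case (Suc n)
    then show ?case using alpha_incl[of "\<one>\<^bsub>G1\<^esub>" c] Suc.IH[of "\<phi>2 c"]
      by (auto intro: image_eqI[where x = "hnn.incl (\<one>\<^bsub>G1\<^esub>, \<phi>2 c)"])
  qed simp
  have one: "(\<phi>2 ^^ k) \<one>\<^bsub>G2\<^esub> = \<one>\<^bsub>G2\<^esub>" for k by (induction k) auto
  have minus: "hnn.incl (g, \<one>\<^bsub>G2\<^esub>) \<in> U_minus hnn.E alpha U" if g: "g \<in> carrier G1" for g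
  proof -
    have "\<one>\<^bsub>G2\<^esub> \<in> (\<phi>2 ^^ k) ` carrier G2" for k using one[of k] by (metis G2.one_closed image_eqI)
    then show ?thesis using g by (simp add: U_minus_iff alpha_pow_incl_in_U_iff)
  qed
  show "U \<subseteq> U_plus alpha U <#>\<^bsub>hnn.E\<^esub> U_minus hnn.E alpha U"
  proof
    fix x assume "x \<in> U"
    then obtain g c where x: "g \<in> carrier G1" "c \<in> carrier G2" "x = hnn.incl (g, c)" by auto
    then have "x = hnn.incl (\<one>\<^bsub>G1\<^esub>, c) \<otimes>\<^bsub>hnn.E\<^esub> hnn.incl (g, \<one>\<^bsub>G2\<^esub>)"
      by (simp flip: hnn.incl.hom_mult)
    moreover have "hnn.incl (\<one>\<^bsub>G1\<^esub>, c) \<in> U_plus alpha U" using plus x by (simp add: U_plus_def)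
    ultimately show "x \<in> U_plus alpha U <#>\<^bsub>hnn.E\<^esub> U_minus hnn.E alpha U"
      using minus[OF x(1)] unfolding set_mult_def by blast
  qed
  show "U_plus alpha U <#>\<^bsub>hnn.E\<^esub> U_minus hnn.E alpha U \<subseteq> U"
  proof
    fix x assume "x \<in> U_plus alpha U <#>\<^bsub>hnn.E\<^esub> U_minus hnn.E alpha U"
    then obtain y z where yz: "y \<in> U_plus alpha U" "z \<in> U_minus hnn.E alpha U" "x = y \<otimes>\<^bsub>hnn.E\<^esub> z"
      by (auto simp: set_mult_def)
    have "y \<in> U_pos alpha U 0" using yz(1) unfolding U_plus_def by blast
    moreover have "(alpha ^^ 0) z \<in> U" using yz(2) unfolding U_minus_iff by blast
    ultimately show "x \<in> U" using subgroup.m_closed[OF U_subgroup] yz(3) by simp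
  qed
qed

lemma U_minus_minus_iff:
  "x \<in> U_minus_minus hnn.E alpha U \<longleftrightarrow> x \<in> carrier hnn.E \<and> (\<exists>n. \<forall>k\<ge>n. (alpha ^^ k) x \<in> U)"
proof -
  have "(\<forall>k. (alpha ^^ k) ((alpha ^^ n) x) \<in> U) \<longleftrightarrow> (\<forall>k\<ge>n. (alpha ^^ k) x \<in> U)" for n
  proof -
    have "(alpha ^^ k) ((alpha ^^ n) x) = (alpha ^^ (k + n)) x" for k by (simp add: funpow_add)
    then show ?thesis by (metis le_add2 le_add_diff_inverse2)
  qed
  then show ?thesis
    using alpha_pow_closed by (auto simp: U_minus_minus_def pow_vimage_def U_minus_iff)
qed

lemma U_minus_minus_subgroup: "subgroup (U_minus_minus hnn.E alpha U) hnn.E"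
proof -
  interpret U: subgroup U hnn.E by (rule U_subgroup)
  interpret \<alpha>n: group_hom hnn.E hnn.E "alpha ^^ n" for n using alpha_pow_hom by unfold_locales
  show ?thesis
  proof (rule hnn.E.subgroupI)
    have "(alpha ^^ k) \<one>\<^bsub>hnn.E\<^esub> \<in> U" for k using U.one_closed by (simp only: \<alpha>n.hom_one)
    then show "U_minus_minus hnn.E alpha U \<noteq> {}" using U_minus_minus_iff hnn.E.one_closed by blast
  next
    fix x assume x: "x \<in> U_minus_minus hnn.E alpha U"
    then obtain n where "\<forall>k\<ge>n. (alpha ^^ k) x \<in> U" by (auto simp: U_minus_minus_iff)
    then have "\<forall>k\<ge>n. (alpha ^^ k) (inv\<^bsub>hnn.E\<^esub> x) \<in> U"
      using x U.m_inv_closed by (simp only: U_minus_minus_iff \<alpha>n.hom_inv) blast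
    then show "inv\<^bsub>hnn.E\<^esub> x \<in> U_minus_minus hnn.E alpha U"
      using x unfolding U_minus_minus_iff by auto
  next
    fix x y assume xy: "x \<in> U_minus_minus hnn.E alpha U" "y \<in> U_minus_minus hnn.E alpha U"
    then obtain m n where mn: "\<forall>k\<ge>m. (alpha ^^ k) x \<in> U" "\<forall>k\<ge>n. (alpha ^^ k) y \<in> U"
      by (auto simp: U_minus_minus_iff)
    have "\<forall>k\<ge>max m n. (alpha ^^ k) (x \<otimes>\<^bsub>hnn.E\<^esub> y) \<in> U"
    proof (intro allI impI)
      fix k assume "max m n \<le> k"
      then have "(alpha ^^ k) x \<in> U" "(alpha ^^ k) y \<in> U" using mn by auto
      then show "(alpha ^^ k) (x \<otimes>\<^bsub>hnn.E\<^esub> y) \<in> U"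
        using xy U.m_closed by (simp only: U_minus_minus_iff \<alpha>n.hom_mult)
    qed
    moreover have "x \<otimes>\<^bsub>hnn.E\<^esub> y \<in> carrier hnn.E"
      using xy unfolding U_minus_minus_iff by simp
    ultimately show "x \<otimes>\<^bsub>hnn.E\<^esub> y \<in> U_minus_minus hnn.E alpha U"
      unfolding U_minus_minus_iff by blast
  qed (auto simp: U_minus_minus_iff)
qed

text \<open>The subgroups \<open>\<phi>\<^sub>2\<^sup>k(G\<^sub>2)\<close> decrease: membership of the second coordinate for large \<open>k\<close>
  implies membership for all \<open>k\<close>.\<close>

lemma U_minus_minus_Int_U: "U_minus_minus hnn.E alpha U \<inter> U = U_minus hnn.E alpha U"
proof
  show "U_minus_minus hnn.E alpha U \<inter> U \<subseteq> U_minus hnn.E alpha U"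
  proof
    fix x assume x: "x \<in> U_minus_minus hnn.E alpha U \<inter> U"
    obtain n where n: "\<forall>k\<ge>n. (alpha ^^ k) x \<in> U" using IntD1[OF x] unfolding U_minus_minus_iff by blast
    obtain g1 g2 where g: "x = hnn.incl (g1, g2)" "g1 \<in> carrier G1" "g2 \<in> carrier G2"
      using x by auto
    have "(alpha ^^ k) x \<in> U" for k
    proof -
      have "(alpha ^^ max n k) x \<in> U" using n by simp
      then have "g2 \<in> (\<phi>2 ^^ max n k) ` carrier G2"
        using alpha_pow_incl_in_U_iff[OF g(2,3)] g(1) by blast
      then have "g2 \<in> (\<phi>2 ^^ k) ` carrier G2"
        using phi2_pow_image_decreasing[of k "max n k"] by auto
      then show ?thesis using alpha_pow_incl_in_U_iff[OF g(2,3)] g(1) by blast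
    qed
    then show "x \<in> U_minus hnn.E alpha U" using IntD1[OF x] unfolding U_minus_iff U_minus_minus_iff by blast
  qed
  show "U_minus hnn.E alpha U \<subseteq> U_minus_minus hnn.E alpha U \<inter> U"
  proof
    fix x assume x: "x \<in> U_minus hnn.E alpha U"
    then have "(alpha ^^ 0) x \<in> U" unfolding U_minus_iff by blast
    moreover have "x \<in> U_minus_minus hnn.E alpha U"
      using x unfolding U_minus_iff U_minus_minus_iff by blast
    ultimately show "x \<in> U_minus_minus hnn.E alpha U \<inter> U" by simp
  qed
qed

text \<open>\<open>U\<^sub>-\<close> is an intersection of preimages of the clopen set \<open>U\<close> under continuous maps, and it is the part
  of the subgroup \<open>U\<^sub>-\<^sub>-\<close> in the open subgroup \<open>U\<close>.\<close>

lemma U_tidy_below: "tidy_below hnn.E hnn.\<T> alpha U"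
proof -
  have "closedin hnn.\<T> U" using U_subgroup U_open by (rule hnn.E.closedin_open_subgroup)
  then have "closedin hnn.\<T> {x \<in> topspace hnn.\<T>. (alpha ^^ k) x \<in> U}" for k
    by (rule closedin_continuous_map_preimage[OF alpha_pow_continuous])
  then have "closedin hnn.\<T> (\<Inter>k. {x \<in> topspace hnn.\<T>. (alpha ^^ k) x \<in> U})"
    by (intro closedin_Inter) auto
  moreover have "(\<Inter>k. {x \<in> topspace hnn.\<T>. (alpha ^^ k) x \<in> U}) = U_minus hnn.E alpha U"
    by (auto simp: U_minus_iff hnn.E.topspace_eq)
  ultimately have "closedin hnn.\<T> (U_minus_minus hnn.E alpha U \<inter> U)"
    by (simp only: U_minus_minus_Int_U)
  then show ?thesis unfolding tidy_below_def
    by (rule hnn.E.closedin_if_locally_closed_subgroup[OF U_subgroup U_open U_minus_minus_subgroup])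
qed

text \<open>Cosets of \<open>U\<close> met by \<open>\<alpha>\<^sup>n(U)\<close> correspond to cosets of \<open>\<phi>\<^sub>2\<^sup>n(G\<^sub>2)\<close> in \<open>G\<^sub>2\<close>.\<close>

lemma alpha_pow_incl_diff:
  assumes "b \<in> carrier (G1 \<times>\<times> G2)" "b' \<in> carrier (G1 \<times>\<times> G2)"
  shows "(alpha ^^ n) (hnn.incl b) \<otimes>\<^bsub>hnn.E\<^esub> inv\<^bsub>hnn.E\<^esub> (alpha ^^ n) (hnn.incl b') \<in> U
    \<longleftrightarrow> snd b \<otimes>\<^bsub>G2\<^esub> inv\<^bsub>G2\<^esub> snd b' \<in> (\<phi>2 ^^ n) ` carrier G2"
proof -
  interpret \<alpha>n: group_hom hnn.E hnn.E "alpha ^^ n" using alpha_pow_hom by unfold_locales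
  obtain g1 g2 h1 h2 where b: "b = (g1, g2)" "b' = (h1, h2)" by (cases b, cases b')
  have c: "g1 \<in> carrier G1" "g2 \<in> carrier G2" "h1 \<in> carrier G1" "h2 \<in> carrier G2"
    using assms b by auto
  have "(alpha ^^ n) (hnn.incl b) \<otimes>\<^bsub>hnn.E\<^esub> inv\<^bsub>hnn.E\<^esub> (alpha ^^ n) (hnn.incl b') =
      (alpha ^^ n) (hnn.incl (b \<otimes>\<^bsub>G1 \<times>\<times> G2\<^esub> inv\<^bsub>G1 \<times>\<times> G2\<^esub> b'))"
    using assms by (simp del: mult_DirProd carrier_DirProd)
  also have "b \<otimes>\<^bsub>G1 \<times>\<times> G2\<^esub> inv\<^bsub>G1 \<times>\<times> G2\<^esub> b' = (g1 \<otimes>\<^bsub>G1\<^esub> inv\<^bsub>G1\<^esub> h1, g2 \<otimes>\<^bsub>G2\<^esub> inv\<^bsub>G2\<^esub> h2)"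
    using c b by (simp add: inv_DirProd[OF G1.is_group G2.is_group])
  finally show ?thesis using c b by (simp add: alpha_pow_incl_in_U_iff)
qed

lemma subgroup_index_U:
  "subgroup_index (hnn.E\<lparr>carrier := alpha ` U\<rparr>) (U \<inter> alpha ` U) = subgroup_index G2 H2"
proof -
  have H2: "subgroup H2 G2" using cos(2) by (simp add: compact_open_subgroup_def)
  let ?B = "carrier G1 \<times> carrier G2"
  define f where "f b = U #>\<^bsub>hnn.E\<^esub> alpha (hnn.incl b)" for b
  define g where "g b = H2 #>\<^bsub>G2\<^esub> snd b" for b :: "'a \<times> 'b"
  have eq: "f b = f b' \<longleftrightarrow> g b = g b'" if b: "b \<in> ?B" "b' \<in> ?B" for b b'
  proof -
    have "f b = f b' \<longleftrightarrow>
        alpha (hnn.incl b) \<otimes>\<^bsub>hnn.E\<^esub> inv\<^bsub>hnn.E\<^esub> alpha (hnn.incl b') \<in> U"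
      unfolding f_def using b by (intro hnn.E.rcos_eq_iff[OF U_subgroup]) auto
    also have "\<dots> \<longleftrightarrow> snd b \<otimes>\<^bsub>G2\<^esub> inv\<^bsub>G2\<^esub> snd b' \<in> H2"
      using alpha_pow_incl_diff[of b b' 1] b phi2(3) by simp
    also have "\<dots> \<longleftrightarrow> g b = g b'"
      unfolding g_def using b by (intro G2.rcos_eq_iff[OF H2, symmetric]) auto
    finally show ?thesis .
  qed
  have "subgroup (alpha ` U) hnn.E" by (rule \<alpha>.subgroup_img_is_subgroup[OF U_subgroup])
  then have "subgroup_index (hnn.E\<lparr>carrier := alpha ` U\<rparr>) (U \<inter> alpha ` U) = card (f ` ?B)"
    by (simp add: hnn.E.subgroup_index_Int[OF U_subgroup] image_image f_def)
  also have "\<dots> = card (g ` ?B)"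
    using eq by (rule card_image_eq_if_same_fibres)
  also have "g ` ?B = rcosets\<^bsub>G2\<^esub> H2"
  proof -
    have "snd ` ?B = carrier G2" using G1.one_closed by force
    moreover have "g ` ?B = (\<lambda>x. H2 #>\<^bsub>G2\<^esub> x) ` snd ` ?B" unfolding image_image
      by (rule image_cong) (simp_all add: g_def)
    ultimately have "g ` ?B = (\<lambda>x. H2 #>\<^bsub>G2\<^esub> x) ` carrier G2" by simp
    then show ?thesis by (auto simp: RCOSETS_def)
  qed
  finally show ?thesis by (simp add: subgroup_index_def)
qed

lemma subgroup_index_ge:
  assumes "compact_open_subgroup hnn.E hnn.\<T> W"
  shows "subgroup_index G2 H2 \<le> subgroup_index (hnn.E\<lparr>carrier := alpha ` W\<rparr>) (W \<inter> alpha ` W)"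
proof (rule hnn.E.index_ge_if_growth[OF U_compact_open assms alpha_hom alpha_continuous])
  fix n
  obtain Y where Y: "Y \<subseteq> carrier G2" "card Y = card (rcosets\<^bsub>G2\<^esub> (\<phi>2 ` carrier G2)) ^ n"
    "\<forall>y\<in>Y. \<forall>y'\<in>Y. y \<otimes>\<^bsub>G2\<^esub> inv\<^bsub>G2\<^esub> y' \<in> (\<phi>2 ^^ n) ` carrier G2 \<longrightarrow> y = y'"
    using G2.powers_of_index[OF phi2(1,2), of n] by (elim exE conjE) (rule that)
  let ?f = "\<lambda>y. hnn.incl (\<one>\<^bsub>G1\<^esub>, y)"
  have "card Y = subgroup_index G2 H2 ^ n" using Y(2) by (simp add: phi2(3) subgroup_index_def)
  moreover have "?f ` Y \<subseteq> U" using Y(1) by auto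
  moreover have "y = y'" if y: "y \<in> Y" "y' \<in> Y"
      and diff: "(alpha ^^ n) (?f y) \<otimes>\<^bsub>hnn.E\<^esub> inv\<^bsub>hnn.E\<^esub> (alpha ^^ n) (?f y') \<in> U" for y y'
  proof -
    have "y \<in> carrier G2" "y' \<in> carrier G2" using y Y(1) by auto
    then have "y \<otimes>\<^bsub>G2\<^esub> inv\<^bsub>G2\<^esub> y' \<in> (\<phi>2 ^^ n) ` carrier G2"
      using alpha_pow_incl_diff[of "(\<one>\<^bsub>G1\<^esub>, y)" "(\<one>\<^bsub>G1\<^esub>, y')" n] diff by simp
    then show ?thesis using Y(3) y by blast
  qed
  ultimately show "\<exists>(Y :: 'b set) f. card Y = subgroup_index G2 H2 ^ n \<and> f ` Y \<subseteq> U \<and>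
      (\<forall>y\<in>Y. \<forall>y'\<in>Y. (alpha ^^ n) (f y) \<otimes>\<^bsub>hnn.E\<^esub> inv\<^bsub>hnn.E\<^esub> (alpha ^^ n) (f y') \<in> U \<longrightarrow> y = y')"
    by (intro exI[of _ Y] exI[of _ ?f] conjI ballI impI)
qed

lemma scale_alpha: "endo_scale hnn.E hnn.\<T> alpha = subgroup_index G2 H2"
  unfolding endo_scale_def
proof (rule Least_equality)
  show "\<exists>W. compact_open_subgroup hnn.E hnn.\<T> W \<and>
      subgroup_index G2 H2 = subgroup_index (hnn.E\<lparr>carrier := alpha ` W\<rparr>) (W \<inter> alpha ` W)"
    using U_compact_open subgroup_index_U by (intro exI[of _ U]) simp
next
  fix m assume "\<exists>W. compact_open_subgroup hnn.E hnn.\<T> W \<and>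
      m = subgroup_index (hnn.E\<lparr>carrier := alpha ` W\<rparr>) (W \<inter> alpha ` W)"
  then show "subgroup_index G2 H2 \<le> m" by (elim exE conjE) (simp add: subgroup_index_ge)
qed

end

theorem lemma7p1:
  fixes G1 :: "('a, 'm) monoid_scheme" and T1 :: "'a topology"
    and G2 :: "('b, 'n) monoid_scheme" and T2 :: "'b topology"
    and H1 :: "'a set" and \<phi>1 :: "'a \<Rightarrow> 'a"
    and H2 :: "'b set" and \<phi>2 :: "'b \<Rightarrow> 'b"
    and B :: "('a \<times> 'b) monoid" and S :: "('a \<times> 'b) topology"
    and A :: "('a \<times> 'b) set" and \<theta> :: "'a \<times> 'b \<Rightarrow> 'a \<times> 'b"
    and G :: "('a \<times> 'b) hnn_letter list set monoid"
    and T :: "('a \<times> 'b) hnn_letter list set topology"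
    and t :: "('a \<times> 'b) hnn_letter list set"
    and U :: "('a \<times> 'b) hnn_letter list set set"
    and \<alpha> \<beta> :: "('a \<times> 'b) hnn_letter list set \<Rightarrow> ('a \<times> 'b) hnn_letter list set"
  assumes "totally_disconnected_compact_group G1 T1"
    and "totally_disconnected_compact_group G2 T2"
    and "compact_open_subgroup G1 T1 H1"
    and "compact_open_subgroup G2 T2 H2"
    and "topological_iso_onto G1 T1 G1 T1 H1 \<phi>1"
    and "topological_iso_onto G2 T2 G2 T2 H2 \<phi>2"
    and "B = G1 \<times>\<times> G2" and "S = prod_topology T1 T2"
    and "A = H1 \<times> carrier G2"
    and "\<theta> = (\<lambda>(h1, g2). (inv_into (carrier G1) \<phi>1 h1, \<phi>2 g2))"
    and "G = hnn_extension B A \<theta>" and "T = hnn_topology B S A \<theta>"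
    and "t = hnn_stable B A \<theta>" and "U = hnn_incl B A \<theta> ` carrier B"
    and "\<beta> = hnn_endo B S A \<theta> (\<lambda>(g1, g2). (\<phi>1 g1, g2))"
    and "\<alpha> = conj_by G t \<circ> \<beta>"
  shows "tidy G T \<alpha> U \<and> endo_scale G T \<alpha> = subgroup_index G2 H2"
proof -
  interpret product_hnn G1 T1 G2 T2 H1 \<phi>1 H2 \<phi>2
    using assms(1-6) by unfold_locales
  have "\<alpha> = alpha" using assms by (simp add: alpha_def beta_def)
  then show ?thesis
    using assms(7-14) U_tidy_above U_tidy_below scale_alpha
    by (simp only: tidy_def simp_thms carrier_DirProd)
qed

end
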